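(* Let $\mathbf{n}=(n_1,\ldots,n_d)\in\mathbb{N}^d$ have pairwise relatively prime entries and let $\boldsymbol{\kappa}\in\mathbb{Z}^d$. For $h\in\mathcal{L}(I^{(2\mathbf{n})}_{\boldsymbol{\kappa}})$, the interpolation problem $$P(\mathbf{z}^{(2\mathbf{n})}_{\mathbf{i}})=h(\mathbf{i})\quad\text{for all }\mathbf{i}\in I^{(2\mathbf{n})}_{\boldsymbol{\kappa}}$$ has in the polynomial space $\Pi^{(2\mathbf{n})}_{\boldsymbol{\kappa}}$ the uniquely determined solution $$P^{(2\mathbf{n})}_{\boldsymbol{\kappa},h}=\sum_{\mathbf{i}\in I^{(2\mathbf{n})}_{\boldsymbol{\kappa}}}h(\mathbf{i})\,L^{(2\mathbf{n})}_{\boldsymbol{\kappa},\mathbf{i}}.$$ Moreover, $\operatorname{span}\{P^{(2\mathbf{n})}_{\boldsymbol{\kappa},h}\mid h\in\mathcal{L}(I^{(2\mathbf{n})}_{\boldsymbol{\kappa}})\}=\Pi^{(2\mathbf{n})}_{\boldsymbol{\kappa}}$ and the polynomials $L^{(2\mathbf{n})}_{\boldsymbol{\kappa},\mathbf{i}}$, $\mathbf{i}\in I^{(2\mathbf{n})}_{\boldsymbol{\kappa}}$, form a basis of $\Pi^{(2\mathbf{n})}_{\boldsymbol{\kappa}}$.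
   Context: $\mathbb{N}=\{1,2,\ldots\}$, $\mathbb{N}_0=\mathbb{N}\cup\{0\}$, $d\in\mathbb{N}$, $p[\mathbf{n}]=\prod_{j=1}^dn_j$. For $\mathfrak{r}\in\{0,1\}$ let $I^{(2\mathbf{n})}_{\boldsymbol{\kappa},\mathfrak{r}}$ be the set of all $\mathbf{i}\in\mathbb{N}_0^d$ with $0\le i_j\le 2n_j$ and $i_j\equiv\kappa_j+\mathfrak{r}\bmod 2$ for all $j$, and $I^{(2\mathbf{n})}_{\boldsymbol{\kappa}}=I^{(2\mathbf{n})}_{\boldsymbol{\kappa},0}\cup I^{(2\mathbf{n})}_{\boldsymbol{\kappa},1}$. $\mathcal{L}(I^{(2\mathbf{n})}_{\boldsymbol{\kappa}})$ is the vector space of all functions $I^{(2\mathbf{n})}_{\boldsymbol{\kappa}}\to\mathbb{C}$. The nodes are $\mathbf{z}^{(2\mathbf{n})}_{\mathbf{i}}=(z^{(2n_1)}_{i_1},\ldots,z^{(2n_d)}_{i_d})$ with $z^{(m)}_i=\cos(i\pi/m)$. For $\mathbf{i}\in I^{(2\mathbf{n})}_{\boldsymbol{\kappa}}$ put $\mathfrak{w}^{(2\mathbf{n})}_{\boldsymbol{\kappa},\mathbf{i}}=2^{\#M}/(2^{d+1}p[\mathbf{n}])$, where $M=\{j\mid 0<i_j<2n_j\}$. $\Gamma^{(2\mathbf{n})}_{\boldsymbol{\kappa}}$ is the union of $\{(0,\ldots,0,2n_d)\}$ and the set of all $\boldsymbol{\gamma}\in\mathbb{N}_0^d$ such that $\gamma_i<2n_i$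 for all $i$, $\gamma_i/n_i+\gamma_j/n_j\le 2$ for all $i\ne j$, and $\gamma_i/n_i+\gamma_j/n_j<2$ for all $i,j$ with $\kappa_i\not\equiv\kappa_j\bmod 2$. With $T_\gamma(x)=\cos(\gamma\arccos x)$, $T_{\boldsymbol{\gamma}}(\mathbf{x})=\prod_{i=1}^dT_{\gamma_i}(x_i)$ for $\mathbf{x}\in[-1,1]^d$, and $\Pi^{(2\mathbf{n})}_{\boldsymbol{\kappa}}$ is the complex linear span of $\{T_{\boldsymbol{\gamma}}\mid\boldsymbol{\gamma}\in\Gamma^{(2\mathbf{n})}_{\boldsymbol{\kappa}}\}$. The norm is the one of the inner product $\langle f,g\rangle=\frac{1}{\pi^d}\int_{[-1,1]^d}f\,\overline{g}\prod_{i=1}^d\frac{1}{\sqrt{1-x_i^2}}\,d\mathbf{x}$, so that $\|T_{\boldsymbol{\gamma}}\|^2=2^{-\#\{i\mid\gamma_i>0\}}$. $\mathfrak{f}^{(2\mathbf{n})}(\boldsymbol{\gamma})=\#\{i\mid\gamma_i=n_i\}-1$ if there is an $i$ with $\gamma_i=n_i$, and $0$ otherwise. For $\mathbf{i}\in I^{(2\mathbf{n})}_{\boldsymbol{\kappa}}$, $$L^{(2\mathbf{n})}_{\boldsymbol{\kappa},\mathbf{i}}(\mathbf{x})=\mathfrak{w}^{(2\mathbf{n})}_{\boldsymbol{\kappa},\mathbf{i}}\Bigl(\sum_{\boldsymbol{\gamma}\in\Gamma^{(2\mathbf{n})}_{\boldsymbol{\kappa}}}\frac{2^{-\mathfrak{f}^{(2\mathbf{n})}(\boldsymbol{\gamma})}}{\|T_{\boldsymbol{\gamma}}\|^2}T_{\boldsymbol{\gamma}}(\mathbf{z}^{(2\mathbf{n})}_{\mathbf{i}})\,T_{\boldsymbol{\gamma}}(\mathbf{x})-T_{2n_d}(z^{(2n_d)}_{i_d})\,T_{2n_d}(x_d)\Bigr),\quad\mathbf{x}\in[-1,1]^d.$$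 *)

theory Defs
  imports "HOL-Analysis.Analysis" "HOL-Library.Function_Algebras" "HOL-Number_Theory.Cong"
begin

text \<open>
  Coordinates are indexed by a finite linearly ordered type \<open>'d\<close>, so that \<open>d = CARD('d)\<close> and the
  last coordinate is \<open>Max UNIV\<close>. Multi-indices are functions \<open>'d \<Rightarrow> nat\<close>. The parameter \<open>n\<close> below
  is the vector \<open>n\<close> itself; the grid parameter \<open>2n\<close> is built into the definitions.
\<close>

text \<open>The complex-valued functions on a set \<open>A\<close>, each represented by its extension by zero. In particular
  functions on the cube are set to zero outside it, so that equality, span and linear independence
  of the representing functions are those on the cube.\<close>

definition fun_on :: "'a set \<Rightarrow> ('a \<Rightarrow> complex) set" where
  "fun_on A = {f. \<forall>x. x \<notin> A \<longrightarrow> f x = 0}"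

global_interpretation cfun: vector_space "\<lambda>(c::complex) (f::'a \<Rightarrow> complex) x. c * f x"
  by standard (auto simp: fun_eq_iff algebra_simps)

definition cube :: "(real ^ 'd::finite) set" where
  "cube = {x. \<forall>i. -1 \<le> x $ i \<and> x $ i \<le> 1}"

text \<open>Only meant for \<open>x \<in> [-1, 1]\<close>, where \<open>arccos\<close> is specified.\<close>

definition cheb :: "nat \<Rightarrow> real \<Rightarrow> real" where
  "cheb m x = cos (real m * arccos x)"

definition chebT :: "('d::finite \<Rightarrow> nat) \<Rightarrow> real ^ 'd::finite \<Rightarrow> complex" where
  "chebT \<gamma> x = (if x \<in> cube then of_real (\<Prod>i\<in>UNIV. cheb (\<gamma> i) (x $ i)) else 0)"

definition cheb_inner ::
    "(real ^ 'd::finite \<Rightarrow> complex) \<Rightarrow> (real ^ 'd::finite \<Rightarrow> complex) \<Rightarrow> complex" where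
  "cheb_inner f g = 1 / of_real pi ^ CARD('d) *
     (LINT x:cube|lborel. f x * cnj (g x) * of_real (\<Prod>i\<in>UNIV. 1 / sqrt (1 - (x $ i)\<^sup>2)))"

definition cheb_norm :: "(real ^ 'd::finite \<Rightarrow> complex) \<Rightarrow> real" where
  "cheb_norm f = sqrt (Re (cheb_inner f f))"

definition index_part :: "('d::finite \<Rightarrow> nat) \<Rightarrow> ('d::finite \<Rightarrow> int) \<Rightarrow> int \<Rightarrow> ('d::finite \<Rightarrow> nat) set" where
  "index_part n \<kappa> r = {i. \<forall>j. i j \<le> 2 * n j \<and> [int (i j) = \<kappa> j + r] (mod 2)}"

definition index_set :: "('d::finite \<Rightarrow> nat) \<Rightarrow> ('d::finite \<Rightarrow> int) \<Rightarrow> ('d::finite \<Rightarrow> nat) set" where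
  "index_set n \<kappa> = index_part n \<kappa> 0 \<union> index_part n \<kappa> 1"

definition node1 :: "nat \<Rightarrow> nat \<Rightarrow> real" where
  "node1 m k = cos (real k * pi / real m)"

definition node :: "('d::finite \<Rightarrow> nat) \<Rightarrow> ('d::finite \<Rightarrow> nat) \<Rightarrow> real ^ 'd::finite" where
  "node n i = (\<chi> j. node1 (2 * n j) (i j))"

definition weight :: "('d::finite \<Rightarrow> nat) \<Rightarrow> ('d::finite \<Rightarrow> nat) \<Rightarrow> real" where
  "weight n i = 2 ^ card {j. 0 < i j \<and> i j < 2 * n j} / (2 ^ (CARD('d) + 1) * real (\<Prod>j\<in>UNIV. n j))"

text \<open>The condition with the strict inequality can only apply for \<open>i \<noteq> j\<close>.\<close>

definition spectral_set ::
    "('d::{finite,linorder} \<Rightarrow> nat) \<Rightarrow> ('d::{finite,linorder} \<Rightarrow> int) \<Rightarrow>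
     ('d::{finite,linorder} \<Rightarrow> nat) set" where
  "spectral_set n \<kappa> =
     {\<lambda>i. if i = Max UNIV then 2 * n i else 0} \<union>
     {\<gamma>. (\<forall>i. \<gamma> i < 2 * n i) \<and>
         (\<forall>i j. i \<noteq> j \<longrightarrow> real (\<gamma> i) / real (n i) + real (\<gamma> j) / real (n j) \<le> 2) \<and>
         (\<forall>i j. \<not> [\<kappa> i = \<kappa> j] (mod 2) \<longrightarrow>
            real (\<gamma> i) / real (n i) + real (\<gamma> j) / real (n j) < 2)}"

definition poly_space ::
    "('d::{finite,linorder} \<Rightarrow> nat) \<Rightarrow> ('d::{finite,linorder} \<Rightarrow> int) \<Rightarrow>
     (real ^ 'd::{finite,linorder} \<Rightarrow> complex) set" where
  "poly_space n \<kappa> = cfun.span (chebT ` spectral_set n \<kappa>)"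

definition defect :: "('d::finite \<Rightarrow> nat) \<Rightarrow> ('d::finite \<Rightarrow> nat) \<Rightarrow> nat" where
  "defect n \<gamma> = (if \<exists>i. \<gamma> i = n i then card {i. \<gamma> i = n i} - 1 else 0)"

definition lagrange ::
    "('d::{finite,linorder} \<Rightarrow> nat) \<Rightarrow> ('d::{finite,linorder} \<Rightarrow> int) \<Rightarrow>
     ('d::{finite,linorder} \<Rightarrow> nat) \<Rightarrow> real ^ 'd::{finite,linorder} \<Rightarrow> complex" where
  "lagrange n \<kappa> i x =
     (if x \<in> cube then
        of_real (weight n i) *
        ((\<Sum>\<gamma>\<in>spectral_set n \<kappa>.
            of_real (1 / 2 ^ defect n \<gamma> / (cheb_norm (chebT \<gamma>))\<^sup>2) * chebT \<gamma> (node n i) * chebT \<gamma> x)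
         - (let l = Max UNIV in
              of_real (cheb (2 * n l) (node1 (2 * n l) (i l)) * cheb (2 * n l) (x $ l))))
      else 0)"

definition interpolant ::
    "('d::{finite,linorder} \<Rightarrow> nat) \<Rightarrow> ('d::{finite,linorder} \<Rightarrow> int) \<Rightarrow>
     (('d::{finite,linorder} \<Rightarrow> nat) \<Rightarrow> complex) \<Rightarrow> real ^ 'd::{finite,linorder} \<Rightarrow> complex"
  where
  "interpolant n \<kappa> h = (\<lambda>x. \<Sum>i\<in>index_set n \<kappa>. h i * lagrange n \<kappa> i x)"

end

theory Submission
  imports Defs
begin

text \<open>
  At the nodes, \<open>T\<^sub>\<gamma>\<close> is a product of cosines \<open>cos (\<gamma>\<^sub>j k\<^sub>j \<pi> / 2 n\<^sub>j)\<close>, and the weighted sum over each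
  of the two parity classes of the grid factorises into one-dimensional trapezoidal sums. Hence two
  such products are orthogonal unless each entry of one index equals the entry of the other or its
  mirror image \<open>2 n\<^sub>j - \<gamma>\<^sub>j\<close>. Mirroring one coordinate multiplies a product by \<open>(-1)\<^bsup>k\<^sub>j\<^esup>\<close>, so mirroring
  two of them changes at most its sign on the grid. By pairwise coprimality there are no ties between
  the ratios \<open>\<gamma>\<^sub>j / n\<^sub>j\<close> in \<open>[0, 1]\<close> except at \<open>0\<close> and \<open>1\<close>, so the spectral set contains exactly one
  representative of every class, under mirroring an even number of coordinates, that does not vanish
  on the grid. Thus its \<open>T\<^sub>\<gamma>\<close> are orthogonal for the discrete inner product, and they span all
  functions on the grid because the products over the full box of indices do. The functions \<open>L\<^sub>i\<close> are
  the resulting Fourier expansions of the point masses.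
\<close>

section \<open>One-dimensional trapezoidal sums\<close>

text \<open>Every interior index is the right end of one unit interval and the left end of the next,
  which accounts for the weight 2.\<close>

lemma trapezoid_sum:
  fixes f :: "nat \<Rightarrow> real"
  assumes "0 < N"
  shows "(\<Sum>t\<le>N. (if 0 < t \<and> t < N then 2 else 1) * f t) = (\<Sum>t<N. f t + f (Suc t))"
proof -
  obtain M where N: "N = Suc M" using assms gr0_implies_Suc by blast
  have "(\<Sum>t\<le>N. (if 0 < t \<and> t < N then 2 else 1) * f t)
      = f 0 + (\<Sum>t<M. 2 * f (Suc t)) + f N"
  proof -
    have "(\<Sum>t\<le>N. (if 0 < t \<and> t < N then 2 else 1) * f t)
      = (\<Sum>t\<le>M. (if 0 < t \<and> t < N then 2 else 1) * f t) + f N"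
      by (simp add: N)
    also have "{..M} = {..<Suc M}" by auto
    also have "(\<Sum>t<Suc M. (if 0 < t \<and> t < N then 2 else 1) * f t) = f 0 + (\<Sum>t<M. 2 * f (Suc t))"
      unfolding sum.lessThan_Suc_shift by (auto simp: N intro!: sum.cong)
    finally show ?thesis .
  qed
  also have "\<dots> = (\<Sum>t<N. f t) + (\<Sum>t<N. f (Suc t))"
    unfolding N sum.lessThan_Suc_shift[of f] sum.lessThan_Suc[of "\<lambda>t. f (Suc t)"]
    by (simp add: sum_distrib_left[symmetric])
  finally show ?thesis by (simp add: sum.distrib)
qed

text \<open>If \<open>2 * N\<close> divides \<open>m\<close>, all cosines are 1. Otherwise
  \<open>sin (x / 2)\<close> is nonzero, and multiplying the sum by it gives a telescoping sum with
  value \<open>cos (x / 2) * sin (N * x)\<close>, where \<open>N * x\<close> is a multiple of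
  pi.\<close>

lemma trapezoid_sum_cos:
  fixes m :: int
  assumes "0 < N"
  shows "(\<Sum>t\<le>N. (if 0 < t \<and> t < N then 2 else 1) * cos (of_int m * (real t * pi / real N)))
    = (if 2 * int N dvd m then 2 * real N else 0)"
proof -
  define x where "x = of_int m * pi / real N"
  have arg: "of_int m * (real t * pi / real N) = real t * x" for t
    by (simp add: x_def)
  have G: "(\<Sum>t\<le>N. (if 0 < t \<and> t < N then 2 else 1) * cos (real t * x))
      = (\<Sum>t<N. cos (real t * x) + cos (real (Suc t) * x))" (is "?G = _")
    by (rule trapezoid_sum[OF assms])
  show ?thesis
  proof (cases "2 * int N dvd m")
    case True
    then obtain k where k: "m = 2 * int N * k" by (elim dvdE)
    have "cos (real t * x) = 1" for t
    proof -
      have "real t * x = 2 * pi * of_int (int t * k)"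
        using assms by (simp add: x_def k)
      then show ?thesis by (metis cos_int_2pin)
    qed
    then have "?G = 2 * real N" unfolding G by (simp del: of_nat_Suc)
    then show ?thesis using True arg by simp
  next
    case False
    have "sin (x / 2) \<noteq> 0"
    proof
      assume "sin (x / 2) = 0"
      then obtain i :: int where "x / 2 = of_int i * pi" by (auto simp: sin_zero_iff_int2)
      then have "of_int m = (of_int (2 * int N * i) :: real)"
        using assms by (simp add: x_def field_simps)
      then have "m = 2 * int N * i" by linarith
      with False show False by simp
    qed
    \<comment> \<open>Around the midpoint \<open>c\<close> of the two angles, both sides become
      \<open>2 * cos c * cos (x / 2) * sin (x / 2)\<close>.\<close>
    have step: "(cos (real t * x) + cos (real (Suc t) * x)) * sin (x / 2)
        = cos (x / 2) * (sin (real (Suc t) * x) - sin (real t * x))" for t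
    proof -
      define c where "c = real t * x + x / 2"
      have 1: "real t * x = c - x / 2" and 2: "real (Suc t) * x = c + x / 2"
        by (simp_all add: c_def algebra_simps)
      show ?thesis unfolding 1 2 by (simp add: cos_add cos_diff sin_add sin_diff algebra_simps)
    qed
    have "?G * sin (x / 2) = cos (x / 2) * (\<Sum>t<N. sin (real (Suc t) * x) - sin (real t * x))"
      unfolding G sum_distrib_right sum_distrib_left by (rule sum.cong[OF refl step])
    also have "(\<Sum>t<N. sin (real (Suc t) * x) - sin (real t * x)) = sin (real N * x)"
      using sum_lessThan_telescope[of "\<lambda>t. sin (real t * x)" N] by simp
    also have "real N * x = of_int m * pi" using assms by (simp add: x_def)
    also have "sin \<dots> = 0" using sin_int_times_real sin_zero_iff_int2 by blast
    finally have "?G = 0" using \<open>sin (x / 2) \<noteq> 0\<close> by simp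
    then show ?thesis using False arg by simp
  qed
qed

text \<open>The power \<open>(-1)^q\<close> for an integer \<open>q\<close> of either sign, because
  the parities \<open>\<kappa>\<close> are integers.\<close>

definition par_sign :: "int \<Rightarrow> real" where
  "par_sign q = (if even q then 1 else -1)"

lemma cong_2_iff_parity: "[a = b] (mod 2) \<longleftrightarrow> (even a \<longleftrightarrow> even (b::int))"
  unfolding cong_def by presburger

lemma par_sign_cong: "[a = b] (mod 2) \<Longrightarrow> par_sign a = par_sign b"
  by (simp add: par_sign_def cong_2_iff_parity)

lemma par_sign_int: "par_sign (int t) = (-1) ^ t"
  by (simp add: par_sign_def)

lemma par_sign_add: "par_sign (a + b) = par_sign a * par_sign b"
  by (auto simp: par_sign_def)

text \<open>Raising the frequency by \<open>N\<close> adds \<open>t * pi\<close> to the angle. Thus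
  a sign given by the parity of \<open>t\<close> can be absorbed into the frequency.\<close>

lemma cos_shift_by_grid:
  assumes "0 < N"
  shows "cos (of_int (m + int N) * (real t * pi / real N))
    = par_sign (int t) * cos (of_int m * (real t * pi / real N))"
proof -
  have "of_int (m + int N) * (real t * pi / real N)
      = of_int m * (real t * pi / real N) + real t * pi"
    using assms by (simp add: field_simps)
  then show ?thesis by (simp add: cos_add par_sign_int)
qed

text \<open>The indicator of the parity class of \<open>q\<close> is
  \<open>(1 + (-1)^(q + t)) / 2\<close>, and the factor \<open>(-1)^t\<close> is a frequency shift
  by \<open>N\<close>. Two full trapezoidal sums remain.\<close>

lemma parity_sum_cos:
  fixes m q :: int
  assumes "0 < N"
  shows "(\<Sum>t | t \<le> N \<and> [int t = q] (mod 2).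
            (if 0 < t \<and> t < N then 2 else 1) * cos (of_int m * (real t * pi / real N)))
    = (if 2 * int N dvd m then real N else 0)
      + par_sign q * (if 2 * int N dvd m + int N then real N else 0)"
proof -
  let ?g = "\<lambda>m t. (if 0 < t \<and> t < N then 2 else 1) * cos (of_int m * (real t * pi / real N))"
  have "(\<Sum>t | t \<le> N \<and> [int t = q] (mod 2). ?g m t)
      = (\<Sum>t\<in>{..N}. if [int t = q] (mod 2) then ?g m t else 0)"
    by (simp add: sum.inter_filter[symmetric])
  also have "\<dots> = (\<Sum>t\<le>N. (?g m t + par_sign q * ?g (m + int N) t) / 2)"
  proof (rule sum.cong[OF refl])
    fix t
    have "par_sign q * par_sign (int t) = (if [int t = q] (mod 2) then 1 else -1)"
      by (simp add: par_sign_def cong_2_iff_parity)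
    then have "par_sign q * (c * (par_sign (int t) * x)) = (if [int t = q] (mod 2) then 1 else -1) * (c * x)"
      for c x
    proof -
      have "par_sign q * (c * (par_sign (int t) * x)) = par_sign q * par_sign (int t) * (c * x)"
        by (simp only: mult_ac)
      also note \<open>par_sign q * par_sign (int t) = _\<close>
      finally show ?thesis .
    qed
    then have "par_sign q * ?g (m + int N) t = (if [int t = q] (mod 2) then 1 else -1) * ?g m t"
      unfolding cos_shift_by_grid[OF assms] by blast
    moreover have "(if P then x else 0) = (x + y) / 2" if "y = (if P then 1 else -1) * x"
      for P and x y :: real
      using that by simp
    ultimately show "(if [int t = q] (mod 2) then ?g m t else 0)
        = (?g m t + par_sign q * ?g (m + int N) t) / 2" by blast
  qed
  also have "\<dots> = ((\<Sum>t\<le>N. ?g m t) + par_sign q * (\<Sum>t\<le>N. ?g (m + int N) t)) / 2"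
    by (simp only: sum.distrib sum_divide_distrib[symmetric] sum_distrib_left)
  also have "\<dots> = (if 2 * int N dvd m then real N else 0)
      + par_sign q * (if 2 * int N dvd m + int N then real N else 0)"
    unfolding trapezoid_sum_cos[OF assms] by (simp add: add_divide_distrib)
  finally show ?thesis .
qed

definition grid_weight :: "nat \<Rightarrow> nat \<Rightarrow> real" where
  "grid_weight N t = (if 0 < t \<and> t < N then 2 else 1)"

text \<open>The Gram entry of the frequencies \<open>a\<close> and \<open>b\<close> over the parity
  class of \<open>q\<close>, divided by \<open>n\<close>. Equal frequencies and mirror images each
  contribute; at \<open>a = b = n\<close> both cases coincide, whence
  \<open>1 + par_sign q\<close>.\<close>

definition cos_factor :: "nat \<Rightarrow> int \<Rightarrow> nat \<Rightarrow> nat \<Rightarrow> real" where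
  "cos_factor n q a b =
     (if a = b then (if a = 0 \<or> a = 2 * n then 2 else if a = n then 1 + par_sign q else 1)
      else if a + b = 2 * n then (if a = 0 \<or> b = 0 then 2 else 1) * par_sign q else 0)"

lemma parity_sum_cos_cos:
  assumes n: "1 \<le> n" and a: "a \<le> 2 * n" and b: "b \<le> 2 * n"
  shows "(\<Sum>t | t \<le> 2 * n \<and> [int t = q] (mod 2).
            grid_weight (2 * n) t * (cos (real a * (real t * pi / real (2 * n)))
              * cos (real b * (real t * pi / real (2 * n)))))
    = real n * cos_factor n q a b"
proof -
  let ?g = "\<lambda>m t. (if 0 < t \<and> t < 2 * n then 2 else 1)
    * cos (of_int m * (real t * pi / real (2 * n)))"
  \<comment> \<open>The four numbers tested below lie strictly between \<open>-8 * n\<close> and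
    \<open>8 * n\<close>, so divisibility by \<open>4 * n\<close> leaves three values.\<close>
  have dvd4: "4 * int n dvd x \<longleftrightarrow> x = - 4 * int n \<or> x = 0 \<or> x = 4 * int n"
    if "-8 * int n < x" "x < 8 * int n" for x
  proof
    assume "4 * int n dvd x"
    then obtain k where k: "x = 4 * int n * k" by (elim dvdE)
    have pos: "0 < 4 * int n" using n by simp
    have "4 * int n * (-2) < 4 * int n * k" "4 * int n * k < 4 * int n * 2"
      using that unfolding k by linarith+
    then have "-2 < k" "k < 2"
      unfolding mult_less_cancel_left_pos[OF pos] .
    then have "k = -1 \<or> k = 0 \<or> k = 1" by linarith
    then show "x = - 4 * int n \<or> x = 0 \<or> x = 4 * int n" using k by auto
  qed auto
  have "(\<Sum>t | t \<le> 2 * n \<and> [int t = q] (mod 2).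
            grid_weight (2 * n) t * (cos (real a * (real t * pi / real (2 * n)))
              * cos (real b * (real t * pi / real (2 * n)))))
     = (\<Sum>t | t \<le> 2 * n \<and> [int t = q] (mod 2). (?g (int a + int b) t + ?g (int a - int b) t) / 2)"
  proof (rule sum.cong[OF refl])
    fix t
    have "cos (real a * u) * cos (real b * u)
        = (cos (of_int (int a + int b) * u) + cos (of_int (int a - int b) * u)) / 2" for u
      by (simp add: distrib_right left_diff_distrib cos_add cos_diff)
    moreover have "c * ((x + y) / 2) = (c * x + c * y) / 2" for c x y :: real
      by (simp add: distrib_left)
    ultimately show "grid_weight (2 * n) t * (cos (real a * (real t * pi / real (2 * n)))
          * cos (real b * (real t * pi / real (2 * n))))
        = (?g (int a + int b) t + ?g (int a - int b) t) / 2"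
      unfolding grid_weight_def by presburger
  qed
  also have "\<dots> = ((\<Sum>t | t \<le> 2 * n \<and> [int t = q] (mod 2). ?g (int a + int b) t)
     + (\<Sum>t | t \<le> 2 * n \<and> [int t = q] (mod 2). ?g (int a - int b) t)) / 2"
    by (simp only: sum.distrib sum_divide_distrib[symmetric])
  also have "\<dots> = real n * ((if 4 * int n dvd int a + int b then 1 else 0)
     + (if 4 * int n dvd int a - int b then 1 else 0)
     + par_sign q * ((if 4 * int n dvd int a + int b + 2 * int n then 1 else 0)
         + (if 4 * int n dvd int a - int b + 2 * int n then 1 else 0)))"
  proof -
    have "(\<Sum>t | t \<le> 2 * n \<and> [int t = q] (mod 2). ?g m t)
        = 2 * real n * ((if 4 * int n dvd m then 1 else 0)
            + par_sign q * (if 4 * int n dvd m + 2 * int n then 1 else 0))" for m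
      using n by (subst parity_sum_cos) (auto simp: distrib_left mult.commute)
    then show ?thesis by (simp only:) (simp add: algebra_simps)
  qed
  also have "\<dots> = real n * cos_factor n q a b"
  proof -
    have 1: "4 * int n dvd int a + int b \<longleftrightarrow> a = b \<and> (a = 0 \<or> a = 2 * n)"
      using n a b by (subst dvd4) auto
    have 2: "4 * int n dvd int a - int b \<longleftrightarrow> a = b"
      using n a b by (subst dvd4) auto
    have 3: "4 * int n dvd int a + int b + 2 * int n \<longleftrightarrow> a + b = 2 * n"
      using n a b by (subst dvd4) auto
    have 4: "4 * int n dvd int a - int b + 2 * int n \<longleftrightarrow> (a = 0 \<and> b = 2 * n) \<or> (a = 2 * n \<and> b = 0)"
      using n a b by (subst dvd4) auto
    show ?thesis unfolding 1 2 3 4 cos_factor_def using n by auto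
  qed
  finally show ?thesis .
qed

text \<open>The matrix \<open>cos (t * k * pi / (2 * n))\<close> is symmetric in \<open>t\<close>
  and \<open>k\<close>, so orthogonality over the sample points is also a relation over the
  frequencies. The coefficients are read off from it.\<close>

lemma cos_interpolation:
  assumes n: "1 \<le> n" and i: "i \<le> 2 * n"
  obtains c :: "nat \<Rightarrow> real" where
    "\<And>k. k \<le> 2 * n \<Longrightarrow>
      (\<Sum>t\<le>2 * n. c t * cos (real t * (real k * pi / real (2 * n)))) = (if i = k then 1 else 0)"
proof
  define D where "D = real n * (cos_factor n 0 i i + cos_factor n 1 i i)"
  have D: "D \<noteq> 0"
    using n by (simp add: D_def cos_factor_def par_sign_def)
  fix k assume k: "k \<le> 2 * n"
  let ?f = "\<lambda>t. grid_weight (2 * n) t * (cos (real i * (real t * pi / real (2 * n)))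
    * cos (real k * (real t * pi / real (2 * n))))"
  have split: "{..2 * n} = {t. t \<le> 2 * n \<and> [int t = 0] (mod 2)} \<union> {t. t \<le> 2 * n \<and> [int t = 1] (mod 2)}"
    by (auto simp: cong_def)
  have "(\<Sum>t\<le>2 * n. ?f t) = (\<Sum>t | t \<le> 2 * n \<and> [int t = 0] (mod 2). ?f t)
      + (\<Sum>t | t \<le> 2 * n \<and> [int t = 1] (mod 2). ?f t)"
    unfolding split by (rule sum.union_disjoint) (auto simp: cong_def)
  \<comment> \<open>With both parity classes added, the mirror terms carry
    \<open>par_sign 0 + par_sign 1 = 0\<close>, so only \<open>i = k\<close> survives.\<close>
  also have "\<dots> = D * (if i = k then 1 else 0)"
    unfolding parity_sum_cos_cos[OF n i k] D_def
    by (auto simp: cos_factor_def par_sign_def distrib_left)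
  finally have S: "(\<Sum>t\<le>2 * n. ?f t) = D * (if i = k then 1 else 0)" .
  have "grid_weight (2 * n) t * cos (real i * (real t * pi / real (2 * n))) / D
        * cos (real t * (real k * pi / real (2 * n))) = ?f t / D" for t
  proof -
    have "real t * (real k * pi / real (2 * n)) = real k * (real t * pi / real (2 * n))" by simp
    then have eq: "cos (real t * (real k * pi / real (2 * n))) = cos (real k * (real t * pi / real (2 * n)))"
      by (rule arg_cong)
    show ?thesis unfolding eq by (simp only: times_divide_eq_left mult.assoc)
  qed
  then have "(\<Sum>t\<le>2 * n. grid_weight (2 * n) t * cos (real i * (real t * pi / real (2 * n))) / D
        * cos (real t * (real k * pi / real (2 * n)))) = (\<Sum>t\<le>2 * n. ?f t) / D"
    unfolding sum_divide_distrib by (intro sum.cong refl)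
  then show "(\<Sum>t\<le>2 * n. grid_weight (2 * n) t * cos (real i * (real t * pi / real (2 * n))) / D
        * cos (real t * (real k * pi / real (2 * n)))) = (if i = k then 1 else 0)"
    unfolding S nonzero_mult_div_cancel_left[OF D] .
qed

section \<open>The continuous Chebyshev norms\<close>

text \<open>Substituting \<open>x = cos u\<close> turns the integral into that of
  \<open>(cos (m * u))^2\<close> over \<open>[0, pi]\<close>, which yields the antiderivative
  \<open>F\<close>. The integrand is unbounded at the ends, but \<open>F\<close> is continuous
  there, so the fundamental theorem for nonnegative functions on the open interval gives
  integrability and the value.\<close>

lemma cheb_weight_integral:
  fixes m :: nat
  defines "w \<equiv> \<lambda>x. indicator {-1..1} x * ((cheb m x)\<^sup>2 * (1 / sqrt (1 - x\<^sup>2)))"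
  shows "integrable lborel w" and "(LINT x|lborel. w x) = (if m = 0 then pi else pi / 2)"
proof -
  define f where "f x = (cheb m x)\<^sup>2 * (1 / sqrt (1 - x\<^sup>2))" for x
  define F where "F x = - (if m = 0 then arccos x
      else arccos x / 2 + sin (2 * (real m * arccos x)) / (4 * real m))" for x
  have pos: "0 < 1 - x\<^sup>2" if "-1 < x" "x < 1" for x :: real
    using that by (simp add: abs_square_less_1 abs_less_iff)
  have deriv: "(F has_real_derivative f x) (at x)" if x: "-1 < x" "x < 1" for x
  proof -
    show ?thesis
    proof (cases "m = 0")
      case True
      then show ?thesis
        using x unfolding F_def[abs_def]
        by (auto intro!: derivative_eq_intros simp: f_def cheb_def divide_inverse)
    next
      case False
      have c: "cos (2 * (real m * arccos x)) = 2 * (cheb m x)\<^sup>2 - 1"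
        unfolding cheb_def by (rule cos_double_cos)
      have "((\<lambda>x. - (arccos x / 2 + sin (2 * (real m * arccos x)) / (4 * real m)))
          has_real_derivative f x) (at x)"
        using False pos[OF x]
        by (auto intro!: derivative_eq_intros x simp: f_def)
          (use c in \<open>simp add: field_simps\<close>)
      then show ?thesis
        unfolding F_def[abs_def] using False by (simp only: if_False)
    qed
  qed
  have contF: "continuous_on {-1..1} F"
    unfolding F_def by (cases "m = 0") (auto intro!: continuous_intros)
  have cont: "isCont f x" if "-1 < x" "x < 1" for x
    unfolding f_def cheb_def using pos[OF that] that by (auto intro!: continuous_intros isCont_arccos)
  have nonneg: "0 \<le> f x" if "-1 < x" "x < 1" for x
    unfolding f_def using pos[OF that] by (auto intro!: mult_nonneg_nonneg)
  have L: "((F \<circ> real_of_ereal) \<longlongrightarrow> F (-1)) (at_right (ereal (-1)))"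
    unfolding ereal_tendsto_simps1
    using contF[unfolded continuous_on_def, rule_format, of "-1"]
    by (simp add: at_within_Icc_at_right)
  have R: "((F \<circ> real_of_ereal) \<longlongrightarrow> F 1) (at_left (ereal 1))"
    unfolding ereal_tendsto_simps1
    using contF[unfolded continuous_on_def, rule_format, of 1]
    by (simp add: at_within_Icc_at_left)
  note FTC = interval_integral_FTC_nonneg[where a = "ereal (-1)" and b = "ereal 1" and F = F and f = f,
      OF _ _ _ _ L R, simplified]
  have val: "F 1 - F (-1) = (if m = 0 then pi else pi / 2)"
    using sin_npi[of "2 * m"] by (simp add: F_def mult.assoc)
  have ae: "AE x in lborel. indicator {-1<..<1} x *\<^sub>R f x = w x"
  proof -
    have "AE x in lborel. x \<noteq> (-1::real)" "AE x in lborel. x \<noteq> (1::real)"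
      by (rule AE_lborel_singleton)+
    then show ?thesis
      by eventually_elim (auto simp: w_def f_def indicator_def)
  qed
  have int0: "integrable lborel (\<lambda>x. indicator {-1<..<1} x *\<^sub>R f x)"
    using FTC(1) deriv cont nonneg by (simp add: set_integrable_def)
  have meas: "w \<in> borel_measurable lborel"
  proof -
    have "continuous_on {-1..1} (\<lambda>x. (cheb m x)\<^sup>2)"
      unfolding cheb_def by (auto intro!: continuous_intros)
    then have "(\<lambda>x. indicator {-1..1} x *\<^sub>R (cheb m x)\<^sup>2) \<in> borel_measurable borel"
      by (intro borel_measurable_continuous_on_indicator) auto
    then have "(\<lambda>x. (indicator {-1..1} x *\<^sub>R (cheb m x)\<^sup>2) * (1 / sqrt (1 - x\<^sup>2))) \<in> borel_measurable borel"
      by measurable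
    then show ?thesis by (simp add: w_def mult_ac)
  qed
  show "integrable lborel w"
    by (rule integrable_cong_AE_imp[OF int0 meas]) (use ae in \<open>auto simp: eq_commute\<close>)
  have "(LINT x|lborel. w x) = (LINT x|lborel. indicator {-1<..<1} x *\<^sub>R f x)"
    by (rule integral_cong_AE[OF meas]) (use int0 ae in \<open>auto simp: eq_commute\<close>)
  also have "\<dots> = F 1 - F (-1)"
    using FTC(2) deriv cont nonneg
    by (simp add: interval_lebesgue_integral_def set_lebesgue_integral_def)
  finally show "(LINT x|lborel. w x) = (if m = 0 then pi else pi / 2)" using val by simp
qed

text \<open>Fubini for a product of functions of single coordinates. Since \<open>lborel\<close> is
  the image of a product measure indexed by \<open>Basis\<close>, coordinates are translated into
  basis vectors along \<open>axis\<close>.\<close>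

lemma integral_vec_prod:
  fixes f :: "'d::finite \<Rightarrow> real \<Rightarrow> real"
  assumes "\<And>i. integrable lborel (f i)"
  shows "(LINT x|lborel. (\<Prod>i\<in>UNIV. f i (x $ i))) = (\<Prod>i\<in>UNIV. LINT t|lborel. f i t)"
proof -
  interpret product_sigma_finite "\<lambda>_. lborel :: real measure" ..
  define g where "g b = f (THE i. b = axis i 1)" for b :: "real ^ 'd"
  have g: "g (axis i 1) = f i" for i
    unfolding g_def by (simp add: axis_eq_axis)
  have Basis: "(Basis :: (real ^ 'd) set) = (\<lambda>i. axis i 1) ` UNIV"
    by (auto simp: Basis_vec_def)
  have inj: "inj (\<lambda>i. axis i 1 :: real ^ 'd)"
    by (auto simp: inj_on_def axis_eq_axis)
  have coord: "(\<Prod>i\<in>UNIV. f i ((\<Sum>b\<in>Basis. y b *\<^sub>R b) $ i)) = (\<Prod>b\<in>Basis. g b (y b))"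
    for y :: "real ^ 'd \<Rightarrow> real"
  proof -
    have "(\<Sum>b\<in>Basis. y b *\<^sub>R b) $ i = y (axis i 1)" for i
      unfolding Basis by (subst sum.reindex[OF inj]) (simp add: axis_def if_distrib cong: if_cong)
    then show ?thesis
      unfolding Basis by (subst prod.reindex[OF inj]) (simp add: g)
  qed
  have meas: "f i \<in> borel_measurable borel" for i
    using borel_measurable_integrable[OF assms[of i]] by simp
  have "(LINT x|lborel. (\<Prod>i\<in>UNIV. f i (x $ i)))
      = (LINT y|(\<Pi>\<^sub>M b\<in>Basis. lborel). (\<Prod>i\<in>UNIV. f i ((\<Sum>b\<in>Basis. y b *\<^sub>R b) $ i)))"
    unfolding lborel_eq[where 'a = "real ^ 'd"]
    by (rule integral_distr) (use meas in measurable)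
  also have "\<dots> = (LINT y|(\<Pi>\<^sub>M b\<in>Basis. lborel). (\<Prod>b\<in>Basis. g b (y b)))"
    by (simp only: coord)
  also have "\<dots> = (\<Prod>b\<in>Basis. LINT t|lborel. g b t)"
    by (rule product_integral_prod) (use assms g in \<open>auto simp: Basis\<close>)
  also have "\<dots> = (\<Prod>i\<in>UNIV. LINT t|lborel. f i t)"
    unfolding Basis by (subst prod.reindex[OF inj]) (simp add: g)
  finally show ?thesis .
qed

text \<open>The integrand is a product over the coordinates, each contributing \<open>pi\<close> or
  \<open>pi / 2\<close>; the powers of \<open>pi\<close> cancel against the normalisation.\<close>

lemma cheb_norm_chebT:
  fixes \<gamma> :: "'d::finite \<Rightarrow> nat"
  shows "(cheb_norm (chebT \<gamma>))\<^sup>2 = 1 / 2 ^ card {i. \<gamma> i > 0}"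
proof -
  define w :: "nat \<Rightarrow> real \<Rightarrow> real" where
    "w m x = indicator {-1..1} x * ((cheb m x)\<^sup>2 * (1 / sqrt (1 - x\<^sup>2)))" for m x
  have ind: "indicator cube x = (\<Prod>i\<in>UNIV. indicator {-1..1} (x $ i) :: real)" for x :: "real ^ 'd"
    by (auto simp: indicator_def cube_def)
  have "(LINT x:cube|lborel. chebT \<gamma> x * cnj (chebT \<gamma> x) * of_real (\<Prod>i\<in>UNIV. 1 / sqrt (1 - (x $ i)\<^sup>2)))
      = (LINT x|lborel. complex_of_real (\<Prod>i\<in>UNIV. w (\<gamma> i) (x $ i)))"
    unfolding set_lebesgue_integral_def
  proof (rule Bochner_Integration.integral_cong[OF refl])
    fix x :: "real ^ 'd"
    show "indicator cube x *\<^sub>R (chebT \<gamma> x * cnj (chebT \<gamma> x) * of_real (\<Prod>i\<in>UNIV. 1 / sqrt (1 - (x $ i)\<^sup>2)))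
      = complex_of_real (\<Prod>i\<in>UNIV. w (\<gamma> i) (x $ i))"
      unfolding w_def prod.distrib ind[symmetric]
      by (auto simp: chebT_def indicator_def prod_power_distrib power2_eq_square prod.distrib)
  qed
  also have "\<dots> = of_real (\<Prod>i\<in>UNIV. if \<gamma> i = 0 then pi else pi / 2)"
    unfolding integral_complex_of_real w_def
    by (subst integral_vec_prod) (simp_all only: cheb_weight_integral)
  also have "(\<Prod>i\<in>UNIV. if \<gamma> i = 0 then pi else pi / 2)
      = (\<Prod>i\<in>(UNIV :: 'd set). pi) * (\<Prod>i\<in>UNIV. if \<gamma> i > 0 then 1 / 2 else 1)"
    by (subst prod.distrib[symmetric], rule prod.cong) auto
  also have "(\<Prod>i\<in>UNIV. if \<gamma> i > 0 then 1 / 2 else (1::real)) = 1 / 2 ^ card {i. \<gamma> i > 0}"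
    by (simp add: prod.If_cases power_one_over)
  finally show ?thesis
    by (simp add: cheb_norm_def cheb_inner_def)
qed

section \<open>Products of cosines on the grid\<close>

text \<open>The value of \<open>chebT \<gamma>\<close> at the node of \<open>k\<close>, as a real
  number; see \<open>chebT_node\<close>.\<close>

definition cos_prod :: "('d::finite \<Rightarrow> nat) \<Rightarrow> ('d \<Rightarrow> nat) \<Rightarrow> ('d \<Rightarrow> nat) \<Rightarrow> real" where
  "cos_prod n \<gamma> k = (\<Prod>j\<in>UNIV. cos (real (\<gamma> j) * (real (k j) * pi / real (2 * n j))))"

definition top_index :: "('d::{finite,linorder} \<Rightarrow> nat) \<Rightarrow> 'd \<Rightarrow> nat" where
  "top_index n = (\<lambda>i. if i = Max UNIV then 2 * n i else 0)"

lemma index_part_eq_PiE: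
  "index_part n \<kappa> r = PiE UNIV (\<lambda>j. {t. t \<le> 2 * n j \<and> [int t = \<kappa> j + r] (mod 2)})"
  by (auto simp: index_part_def PiE_def Pi_def)

lemma finite_index_part: "finite (index_part n \<kappa> r)"
  unfolding index_part_eq_PiE by (rule finite_PiE) auto

lemma finite_index_set: "finite (index_set n \<kappa>)"
  by (simp add: index_set_def finite_index_part)

lemma index_set_le: "k \<in> index_set n \<kappa> \<Longrightarrow> k j \<le> 2 * n j"
  by (auto simp: index_set_def index_part_def)

lemma weight_eq_prod:
  fixes n :: "'d::finite \<Rightarrow> nat"
  shows "weight n k = (\<Prod>j\<in>UNIV. grid_weight (2 * n j) (k j)) / (2 ^ (CARD('d) + 1) * real (\<Prod>j\<in>UNIV. n j))"
  by (simp add: weight_def grid_weight_def prod.If_cases)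

text \<open>Each parity class is a box and the weight is a product, so the sum over a class
  factorises into one-dimensional sums. Their factors \<open>n j\<close> cancel the product in the
  denominator of the weight.\<close>

lemma weight_sum_cos_prod:
  fixes n :: "'d::finite \<Rightarrow> nat"
  assumes n: "\<And>j. n j \<ge> 1" and a: "\<And>j. a j \<le> 2 * n j" and b: "\<And>j. b j \<le> 2 * n j"
  shows "(\<Sum>k\<in>index_set n \<kappa>. weight n k * (cos_prod n a k * cos_prod n b k))
    = ((\<Prod>j\<in>UNIV. cos_factor (n j) (\<kappa> j) (a j) (b j))
      + (\<Prod>j\<in>UNIV. cos_factor (n j) (\<kappa> j + 1) (a j) (b j))) / 2 ^ (CARD('d) + 1)"
proof -
  let ?C = "2 ^ (CARD('d) + 1) * real (\<Prod>j\<in>UNIV. n j)"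
  let ?u = "\<lambda>k. weight n k * (cos_prod n a k * cos_prod n b k)"
  let ?g = "\<lambda>j t. grid_weight (2 * n j) t * (cos (real (a j) * (real t * pi / real (2 * n j)))
      * cos (real (b j) * (real t * pi / real (2 * n j))))"
  have part: "(\<Sum>k\<in>index_part n \<kappa> r. ?u k)
      = (\<Prod>j\<in>UNIV. cos_factor (n j) (\<kappa> j + r) (a j) (b j)) / 2 ^ (CARD('d) + 1)" for r
  proof -
    have "(\<Sum>k\<in>index_part n \<kappa> r. ?u k) = (\<Sum>k\<in>index_part n \<kappa> r. (\<Prod>j\<in>UNIV. ?g j (k j)) / ?C)"
      unfolding weight_eq_prod cos_prod_def prod.distrib by (simp add: field_simps)
    also have "\<dots> = (\<Prod>j\<in>UNIV. \<Sum>t | t \<le> 2 * n j \<and> [int t = \<kappa> j + r] (mod 2). ?g j t) / ?C"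
      unfolding index_part_eq_PiE sum_divide_distrib[symmetric] by (subst prod_sum_PiE) auto
    also have "\<dots> = (\<Prod>j\<in>UNIV. real (n j) * cos_factor (n j) (\<kappa> j + r) (a j) (b j)) / ?C"
      by (simp only: parity_sum_cos_cos[OF n a b])
    also have "\<dots> = (\<Prod>j\<in>UNIV. cos_factor (n j) (\<kappa> j + r) (a j) (b j)) / 2 ^ (CARD('d) + 1)"
      using n[THEN order_less_le_trans[OF zero_less_one]] by (simp add: prod.distrib)
    finally show ?thesis .
  qed
  have "index_part n \<kappa> 0 \<inter> index_part n \<kappa> 1 = {}"
    by (auto simp: index_part_def cong_2_iff_parity)
  then have "(\<Sum>k\<in>index_set n \<kappa>. ?u k) = (\<Sum>k\<in>index_part n \<kappa> 0. ?u k) + (\<Sum>k\<in>index_part n \<kappa> 1. ?u k)"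
    unfolding index_set_def by (intro sum.union_disjoint finite_index_part)
  then show ?thesis
    unfolding part by (simp add: add_divide_distrib)
qed

lemma cos_reflect:
  assumes "1 \<le> n" "a \<le> 2 * n"
  shows "cos (real (2 * n - a) * (real t * pi / real (2 * n)))
    = par_sign (int t) * cos (real a * (real t * pi / real (2 * n)))"
proof -
  have "real (2 * n - a) * (real t * pi / real (2 * n)) = real t * pi - real a * (real t * pi / real (2 * n))"
    using assms by (simp add: of_nat_diff field_simps)
  then show ?thesis by (simp only: cos_diff cos_npi sin_npi par_sign_int)
qed

lemma cos_half_eq_0:
  assumes "1 \<le> n" "odd t"
  shows "cos (real n * (real t * pi / real (2 * n))) = 0"
proof -
  have "real n * (real t * pi / real (2 * n)) = real t * (pi / 2)" using assms by simp
  then show ?thesis using assms(2) by (auto simp: cos_zero_iff)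
qed

lemma prod_delta_eq:
  fixes i k :: "'d::finite \<Rightarrow> 'a"
  shows "(\<Prod>j\<in>UNIV. if i j = k j then 1 else 0) = (if i = k then 1 else (0 :: real))"
  by (auto simp: fun_eq_iff)

text \<open>The coefficients are products of the one-dimensional ones, so the sum over the box
  factorises. This holds on the full product grid, which contains \<open>index_set\<close>.\<close>

lemma delta_full_grid:
  fixes n :: "'d::finite \<Rightarrow> nat"
  assumes n: "\<And>j. n j \<ge> 1" and i: "\<And>j. i j \<le> 2 * n j"
  obtains c where "\<And>k. (\<And>j. k j \<le> 2 * n j) \<Longrightarrow>
    (\<Sum>\<gamma>\<in>PiE UNIV (\<lambda>j. {..2 * n j}). c \<gamma> * cos_prod n \<gamma> k) = (if i = k then 1 else 0)"
proof -
  have "\<exists>c. \<forall>k\<le>2 * n j. (\<Sum>t\<le>2 * n j. c t * cos (real t * (real k * pi / real (2 * n j))))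
      = (if i j = k then 1 else 0)" for j
    by (rule cos_interpolation[OF n[of j] i[of j]]) blast
  then have "\<forall>j. \<exists>c. \<forall>k\<le>2 * n j. (\<Sum>t\<le>2 * n j. c t * cos (real t * (real k * pi / real (2 * n j))))
      = (if i j = k then 1 else 0)" ..
  then obtain c where c: "\<And>j k. k \<le> 2 * n j \<Longrightarrow>
      (\<Sum>t\<le>2 * n j. c j t * cos (real t * (real k * pi / real (2 * n j)))) = (if i j = k then 1 else 0)"
    unfolding choice_iff by blast
  show thesis
  proof (rule that[of "\<lambda>\<gamma>. \<Prod>j\<in>UNIV. c j (\<gamma> j)"])
    fix k assume k: "\<And>j. k j \<le> 2 * n j"
    have "(\<Sum>\<gamma>\<in>PiE UNIV (\<lambda>j. {..2 * n j}). (\<Prod>j\<in>UNIV. c j (\<gamma> j)) * cos_prod n \<gamma> k)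
        = (\<Prod>j\<in>UNIV. \<Sum>t\<le>2 * n j. c j t * cos (real t * (real (k j) * pi / real (2 * n j))))"
      by (subst prod_sum_PiE) (auto simp: cos_prod_def prod.distrib)
    also have "\<dots> = (if i = k then 1 else 0)"
      by (simp only: c[OF k] prod_delta_eq)
    finally show "(\<Sum>\<gamma>\<in>PiE UNIV (\<lambda>j. {..2 * n j}). (\<Prod>j\<in>UNIV. c j (\<gamma> j)) * cos_prod n \<gamma> k)
        = (if i = k then 1 else 0)" .
  qed
qed

text \<open>The subtraction is truncated, so this is a reflection, and an involution, only for
  \<open>\<gamma> j \<le> 2 * n j\<close>.\<close>

definition flip :: "('d \<Rightarrow> nat) \<Rightarrow> 'd set \<Rightarrow> ('d \<Rightarrow> nat) \<Rightarrow> 'd \<Rightarrow> nat" where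
  "flip n F \<gamma> = (\<lambda>j. if j \<in> F then 2 * n j - \<gamma> j else \<gamma> j)"

lemma sum_fun_apply: "(\<Sum>a\<in>A. f a) = (\<lambda>x. \<Sum>a\<in>A. f a x)"
  by (induction A rule: infinite_finite_induct) (simp_all add: fun_eq_iff)

section \<open>Arithmetic of the spectral set and discrete orthogonality\<close>

locale coprime_grid =
  fixes n :: "'d::{finite,linorder} \<Rightarrow> nat" and \<kappa> :: "'d \<Rightarrow> int"
  assumes n_pos: "\<And>j. n j \<ge> 1"
    and n_coprime: "\<And>i j. i \<noteq> j \<Longrightarrow> coprime (n i) (n j)"
begin

text \<open>This is where coprimality enters: a tie between the ratios \<open>a / n i\<close> and
  \<open>b / n j\<close> forces \<open>a / n i\<close> to be an integer.\<close>

lemma ratio_eq_dvd: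
  assumes "i \<noteq> j" "a * n j = b * n i"
  shows "n i dvd a"
  using assms(2) coprime_dvd_mult_left_iff[OF n_coprime[OF assms(1)], of a] by simp

lemma sum_ratio_le_iff:
  "real a / real (n i) + real b / real (n j) \<le> 2 \<longleftrightarrow> a * n j + b * n i \<le> 2 * n i * n j"
proof -
  have "real a / real (n i) + real b / real (n j) \<le> 2
      \<longleftrightarrow> real a * real (n j) + real b * real (n i) \<le> 2 * real (n i) * real (n j)"
    using n_pos[of i] n_pos[of j] by (simp add: field_simps)
  also have "\<dots> \<longleftrightarrow> real (a * n j + b * n i) \<le> real (2 * n i * n j)" by simp
  finally show ?thesis unfolding of_nat_le_iff .
qed

lemma spectral_set_eq:
  "spectral_set n \<kappa> = insert (top_index n)
     {\<gamma>. (\<forall>i. \<gamma> i < 2 * n i) \<and>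
         (\<forall>i j. i \<noteq> j \<longrightarrow> real (\<gamma> i) / real (n i) + real (\<gamma> j) / real (n j) \<le> 2) \<and>
         (\<forall>i j. \<not> [\<kappa> i = \<kappa> j] (mod 2) \<longrightarrow>
            real (\<gamma> i) / real (n i) + real (\<gamma> j) / real (n j) < 2)}"
  by (simp add: spectral_set_def top_index_def)

lemma top_index_in_spectral_set: "top_index n \<in> spectral_set n \<kappa>"
  by (simp add: spectral_set_eq)

lemma spectral_set_le: "\<gamma> \<in> spectral_set n \<kappa> \<Longrightarrow> \<gamma> j \<le> 2 * n j"
  by (auto simp: spectral_set_eq top_index_def intro: less_imp_le)

lemma finite_spectral_set: "finite (spectral_set n \<kappa>)"
proof (rule finite_subset)
  show "spectral_set n \<kappa> \<subseteq> PiE UNIV (\<lambda>j. {..2 * n j})"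
    using spectral_set_le by (auto simp: PiE_def)
qed (auto intro: finite_PiE)

lemma spectral_set_pair:
  assumes "\<gamma> \<in> spectral_set n \<kappa>" "i \<noteq> j"
  shows "\<gamma> i * n j + \<gamma> j * n i \<le> 2 * n i * n j"
  using assms unfolding spectral_set_eq sum_ratio_le_iff by (auto simp: top_index_def)

lemma spectral_set_max:
  assumes "\<gamma> \<in> spectral_set n \<kappa>" "\<gamma> i = 2 * n i"
  shows "\<gamma> = top_index n" "i = Max UNIV"
proof -
  show "\<gamma> = top_index n"
  proof (rule ccontr)
    assume "\<not> ?thesis"
    then have "\<gamma> i < 2 * n i" using assms(1) by (simp add: spectral_set_eq)
    with assms(2) show False by simp
  qed
  then show "i = Max UNIV"
    using assms(2) n_pos[of i] by (auto simp: top_index_def split: if_splits)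
qed

text \<open>Two ratios equal to 1 add up to exactly 2, against the strict inequality for different
  parities. The exceptional element has no entry equal to \<open>n i\<close>.\<close>

lemma spectral_set_mid:
  assumes "\<gamma> \<in> spectral_set n \<kappa>" "\<gamma> i = n i" "\<gamma> j = n j"
  shows "[\<kappa> i = \<kappa> j] (mod 2)"
proof (rule ccontr)
  assume neq: "\<not> ?thesis"
  have "\<gamma> \<noteq> top_index n"
    using assms(2) n_pos[of i] neq assms(3) n_pos[of j] by (auto simp: top_index_def split: if_splits)
  then have "real (\<gamma> i) / real (n i) + real (\<gamma> j) / real (n j) < 2"
    using assms(1) neq by (simp add: spectral_set_eq)
  then show False using assms(2,3) n_pos[of i] n_pos[of j] by simp
qed

text \<open>On the grid \<open>k i\<close> and \<open>k j\<close> then have different parities, and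
  the odd one gives a cosine at an odd multiple of \<open>pi / 2\<close>.\<close>

lemma cos_prod_eq_0:
  assumes k: "k \<in> index_set n \<kappa>" and neq: "\<not> [\<kappa> i = \<kappa> j] (mod 2)"
    and \<gamma>: "\<gamma> i = n i" "\<gamma> j = n j"
  shows "cos_prod n \<gamma> k = 0"
proof -
  have "odd (k i) \<or> odd (k j)"
    using k neq by (auto simp: index_set_def index_part_def cong_2_iff_parity)
  then have "cos (real (\<gamma> i) * (real (k i) * pi / real (2 * n i))) = 0
      \<or> cos (real (\<gamma> j) * (real (k j) * pi / real (2 * n j))) = 0"
    unfolding \<gamma> using cos_half_eq_0[OF n_pos] by blast
  then show ?thesis unfolding cos_prod_def by (intro prod_zero) auto
qed

text \<open>The indices turn out to differ in the coordinate \<open>i\<close> only. Passing from one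
  parity class to the other then changes exactly one sign, and the two products cancel.\<close>

lemma cos_factor_prod_cancel:
  assumes a: "a \<in> spectral_set n \<kappa>" and b: "b \<in> spectral_set n \<kappa>"
    and mirror: "\<And>j. a j = b j \<or> a j + b j = 2 * n j"
    and i: "a i \<noteq> b i" "n i < a i"
  shows "(\<Prod>j\<in>UNIV. cos_factor (n j) (\<kappa> j) (a j) (b j))
      + (\<Prod>j\<in>UNIV. cos_factor (n j) (\<kappa> j + 1) (a j) (b j)) = 0"
proof -
  have lt: "a j < n j" if "j \<noteq> i" for j
  proof (rule ccontr)
    assume "\<not> ?thesis"
    then have "n i * n j \<le> a j * n i" by simp
    moreover have "n i * n j < a i * n j" using i(2) n_pos[of j] by simp
    ultimately show False using spectral_set_pair[OF a that[symmetric]] by linarith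
  qed
  \<comment> \<open>If \<open>j\<close> were mirrored too, the ratio sums of \<open>a\<close> and of
    \<open>b\<close> would add up to 4, so both equal 2, and \<open>a i / n i\<close> ties with
    \<open>b j / n j\<close>. As this ratio is an integer in \<open>(1, 2]\<close>, it is 2, so
    \<open>i\<close> and \<open>j\<close> would both be the last coordinate.\<close>
  have eq: "a j = b j" if "j \<noteq> i" for j
  proof (rule ccontr)
    assume "a j \<noteq> b j"
    then have bj: "a j + b j = 2 * n j" using mirror by blast
    have bi: "a i + b i = 2 * n i" using mirror i by blast
    have "(a i + b i) * n j + (a j + b j) * n i = 4 * n i * n j"
      by (simp add: bi bj)
    then have "a i * n j + a j * n i + (b i * n j + b j * n i) = 4 * n i * n j"
      by (simp add: algebra_simps)
    then have "a i * n j + a j * n i = 2 * n i * n j"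
      using spectral_set_pair[OF a that[symmetric]] spectral_set_pair[OF b that[symmetric]]
      by linarith
    moreover have "a j * n i + b j * n i = 2 * n i * n j"
      unfolding distrib_right[symmetric] bj by simp
    ultimately have tie: "a i * n j = b j * n i" by linarith
    then have "n i dvd a i" by (rule ratio_eq_dvd[OF that[symmetric]])
    then obtain m where m: "a i = n i * m" by (elim dvdE)
    have "n i * 1 < n i * m" "n i * m \<le> n i * 2"
      using i(2) spectral_set_le[OF a, of i] m by simp_all
    then have "m = 2" using n_pos[of i] by (simp only: mult_less_cancel1 mult_le_cancel1) simp
    then have ai: "a i = 2 * n i" using m by simp
    then have "b j = 2 * n j" using tie n_pos[of i] by simp
    then show False
      using spectral_set_max(2)[OF a ai] spectral_set_max(2)[OF b, of j] that by simp
  qed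
  let ?P = "\<lambda>r. \<Prod>j\<in>UNIV - {i}. cos_factor (n j) (\<kappa> j + r) (a j) (b j)"
  \<comment> \<open>Away from \<open>i\<close> the entries are equal and below \<open>n j\<close>,
    where \<open>cos_factor\<close> does not depend on the parity.\<close>
  have P: "?P 1 = ?P 0"
  proof (rule prod.cong[OF refl])
    fix j assume "j \<in> UNIV - {i}"
    then show "cos_factor (n j) (\<kappa> j + 1) (a j) (b j) = cos_factor (n j) (\<kappa> j + 0) (a j) (b j)"
      using eq[of j] lt[of j] by (simp add: cos_factor_def)
  qed
  have "cos_factor (n i) (\<kappa> i + 1) (a i) (b i) = - cos_factor (n i) (\<kappa> i) (a i) (b i)"
    using i by (simp add: cos_factor_def par_sign_def)
  then show ?thesis
    using P by (simp add: prod.remove[where x = i])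
qed

text \<open>If some coordinate is neither equal nor mirrored, its factor vanishes in both classes.
  Otherwise one of two differing entries exceeds \<open>n i\<close>, and the cancellation applies,
  with \<open>a\<close> and \<open>b\<close> exchanged if necessary.\<close>

lemma cos_prod_orthogonal:
  assumes a: "a \<in> spectral_set n \<kappa>" and b: "b \<in> spectral_set n \<kappa>" and "a \<noteq> b"
  shows "(\<Sum>k\<in>index_set n \<kappa>. weight n k * (cos_prod n a k * cos_prod n b k)) = 0"
proof -
  have "(\<Prod>j\<in>UNIV. cos_factor (n j) (\<kappa> j) (a j) (b j))
      + (\<Prod>j\<in>UNIV. cos_factor (n j) (\<kappa> j + 1) (a j) (b j)) = 0"
  proof (cases "\<forall>j. a j = b j \<or> a j + b j = 2 * n j")
    case True
    obtain i where i: "a i \<noteq> b i" using \<open>a \<noteq> b\<close> by blast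
    then have "a i + b i = 2 * n i" using True by blast
    then have "n i < a i \<or> n i < b i" using i by linarith
    then show ?thesis
    proof
      assume "n i < a i"
      then show ?thesis using cos_factor_prod_cancel[OF a b] True i by blast
    next
      assume "n i < b i"
      then have "(\<Prod>j\<in>UNIV. cos_factor (n j) (\<kappa> j) (b j) (a j))
          + (\<Prod>j\<in>UNIV. cos_factor (n j) (\<kappa> j + 1) (b j) (a j)) = 0"
        using True i by (intro cos_factor_prod_cancel[OF b a, of i]) (auto simp: eq_commute add.commute)
      moreover have "cos_factor m q (b j) (a j) = cos_factor m q (a j) (b j)" for m q j
        by (auto simp: cos_factor_def add.commute)
      ultimately show ?thesis by simp
    qed
  next
    case False
    then obtain j where "a j \<noteq> b j" "a j + b j \<noteq> 2 * n j" by blast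
    then have "cos_factor (n j) q (a j) (b j) = 0" for q
      by (simp add: cos_factor_def)
    then have zero: "(\<Prod>j\<in>UNIV. cos_factor (n j) (f j) (a j) (b j)) = 0" for f :: "'d \<Rightarrow> int"
      by (intro prod_zero) auto
    show ?thesis using zero[of \<kappa>] zero[of "\<lambda>j. \<kappa> j + 1"] by linarith
  qed
  then show ?thesis
    by (simp add: weight_sum_cos_prod[OF n_pos spectral_set_le[OF a] spectral_set_le[OF b]])
qed

text \<open>This is the origin of the factor \<open>2 ^ defect n a\<close>: it comes from the
  coordinates with \<open>a j = n j\<close>, each its own mirror image.\<close>

lemma weight_sum_cos_prod_square:
  assumes a: "a \<in> spectral_set n \<kappa>"
  shows "(\<Sum>k\<in>index_set n \<kappa>. weight n k * (cos_prod n a k * cos_prod n a k))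
    = 2 ^ card {j. a j = 0 \<or> a j = 2 * n j} * 2 ^ defect n a / 2 ^ CARD('d)"
proof -
  let ?N = "{j. a j = n j}"
  have prod: "(\<Prod>j\<in>UNIV. cos_factor (n j) (\<kappa> j + r) (a j) (a j))
      = 2 ^ card {j. a j = 0 \<or> a j = 2 * n j} * (\<Prod>j\<in>?N. 1 + par_sign (\<kappa> j + r))" for r
  proof -
    have "cos_factor (n j) (\<kappa> j + r) (a j) (a j)
        = (if a j = 0 \<or> a j = 2 * n j then 2 else 1) * (if a j = n j then 1 + par_sign (\<kappa> j + r) else 1)"
      for j using n_pos[of j] by (auto simp: cos_factor_def)
    then show ?thesis by (simp add: prod.distrib prod.If_cases)
  qed
  \<comment> \<open>For empty \<open>?N\<close> both products are 1. Otherwise all signs over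
    \<open>?N\<close> agree by \<open>spectral_set_mid\<close>, so one parity class gives
    \<open>2 ^ card ?N\<close> and the other gives 0.\<close>
  have sum: "(\<Prod>j\<in>?N. 1 + par_sign (\<kappa> j + 0)) + (\<Prod>j\<in>?N. 1 + par_sign (\<kappa> j + 1))
      = 2 * 2 ^ defect n a"
  proof (cases "?N = {}")
    case True
    then show ?thesis by (auto simp: defect_def)
  next
    case False
    then obtain i where i: "a i = n i" by blast
    have card: "card ?N = Suc (defect n a)"
      using False by (auto simp: defect_def card_gt_0_iff)
    have "par_sign (\<kappa> j + r) = par_sign (\<kappa> i + r)" if "j \<in> ?N" for j r
      using spectral_set_mid[OF a _ i] that by (auto intro!: par_sign_cong cong_add)
    then have "(\<Prod>j\<in>?N. 1 + par_sign (\<kappa> j + r)) = (1 + par_sign (\<kappa> i + r)) ^ Suc (defect n a)" for r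
      unfolding card[symmetric] by simp
    then show ?thesis by (simp only:) (simp add: par_sign_def)
  qed
  have "(\<Prod>j\<in>UNIV. cos_factor (n j) (\<kappa> j) (a j) (a j))
      + (\<Prod>j\<in>UNIV. cos_factor (n j) (\<kappa> j + 1) (a j) (a j))
      = 2 ^ card {j. a j = 0 \<or> a j = 2 * n j} * (2 * 2 ^ defect n a)"
    unfolding sum[symmetric] distrib_left prod[symmetric] by simp
  then show ?thesis
    by (simp add: weight_sum_cos_prod[OF n_pos spectral_set_le[OF a] spectral_set_le[OF a]])
qed

section \<open>Completeness\<close>

lemma cos_prod_flip:
  assumes "\<And>j. \<gamma> j \<le> 2 * n j"
  shows "cos_prod n (flip n F \<gamma>) k = (\<Prod>j\<in>F. par_sign (int (k j))) * cos_prod n \<gamma> k"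
proof -
  have "cos (real (flip n F \<gamma> j) * (real (k j) * pi / real (2 * n j)))
      = (if j \<in> F then par_sign (int (k j)) else 1) * cos (real (\<gamma> j) * (real (k j) * pi / real (2 * n j)))" for j
    using cos_reflect[OF n_pos assms, of j "k j"] by (simp add: flip_def)
  then show ?thesis
    by (simp add: cos_prod_def prod.distrib prod.If_cases)
qed

text \<open>The sign \<open>r\<close> depends on \<open>k\<close> but not on \<open>j\<close>. Hence
  flipping an even number of coordinates multiplies \<open>cos_prod\<close> on the grid by a sign
  independent of \<open>k\<close>.\<close>

lemma index_set_par_sign:
  assumes "k \<in> index_set n \<kappa>"
  obtains r where "r = 1 \<or> r = -1" "\<And>j. par_sign (int (k j)) = par_sign (\<kappa> j) * r"
proof -
  obtain q where "k \<in> index_part n \<kappa> q" using assms by (auto simp: index_set_def)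
  then have "par_sign (int (k j)) = par_sign (\<kappa> j) * par_sign q" for j
    unfolding par_sign_add[symmetric] by (auto simp: index_part_def intro: par_sign_cong)
  moreover have "par_sign q = 1 \<or> par_sign q = -1" by (simp add: par_sign_def)
  ultimately show thesis using that by blast
qed

lemma reduced_in_spectral_set:
  assumes le: "\<And>j. \<delta> j \<le> n j"
    and mid: "\<And>i j. \<delta> i = n i \<Longrightarrow> \<delta> j = n j \<Longrightarrow> [\<kappa> i = \<kappa> j] (mod 2)"
  shows "\<delta> \<in> spectral_set n \<kappa>"
proof -
  have pos: "0 < real (n j)" for j using n_pos[of j] by simp
  have le1: "real (\<delta> j) / real (n j) \<le> 1" for j
    using le[of j] pos[of j] by simp
  have "real (\<delta> i) / real (n i) + real (\<delta> j) / real (n j) < 2" if "\<not> [\<kappa> i = \<kappa> j] (mod 2)" for i j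
  proof -
    have "\<delta> i \<noteq> n i \<or> \<delta> j \<noteq> n j" using mid that by blast
    then have "real (\<delta> i) / real (n i) \<noteq> 1 \<or> real (\<delta> j) / real (n j) \<noteq> 1"
      using pos[of i] pos[of j] by auto
    then show ?thesis using le1[of i] le1[of j] by linarith
  qed
  moreover have "real (\<delta> i) / real (n i) + real (\<delta> j) / real (n j) \<le> 2" for i j
    using le1[of i] le1[of j] by linarith
  moreover have "\<delta> j < 2 * n j" for j
    using le[of j] n_pos[of j] by linarith
  ultimately show ?thesis by (simp add: spectral_set_eq)
qed

text \<open>Flipping the largest ratio \<open>x m\<close> produces sums
  \<open>2 - x m + x j\<close>, at most 2, with equality only for a tie. By coprimality and
  \<open>pos\<close>, a tie occurs only at ratio 1, which \<open>mid\<close> excludes for different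
  parities.\<close>

lemma flip_max_in_spectral_set:
  assumes le: "\<And>j. \<delta> j \<le> n j"
    and mid: "\<And>i j. \<delta> i = n i \<Longrightarrow> \<delta> j = n j \<Longrightarrow> [\<kappa> i = \<kappa> j] (mod 2)"
    and pos: "0 < \<delta> m"
    and max: "\<And>j. real (\<delta> j) / real (n j) \<le> real (\<delta> m) / real (n m)"
  shows "flip n {m} \<delta> \<in> spectral_set n \<kappa>"
proof -
  define x where "x j = real (\<delta> j) / real (n j)" for j
  have n0: "0 < real (n j)" for j using n_pos[of j] by simp
  have x1: "x j \<le> 1" for j
    unfolding x_def using le[of j] n0[of j] by simp
  have x1_iff: "x j = 1 \<longleftrightarrow> \<delta> j = n j" for j
    unfolding x_def using n0[of j] by auto
  have max: "x j \<le> x m" for j using max by (simp add: x_def)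
  have flip: "real (flip n {m} \<delta> j) / real (n j) = (if j = m then 2 - x m else x j)" for j
    using le[of m] n0[of m] by (simp add: flip_def x_def of_nat_diff diff_divide_distrib)
  have tie: "x m = 1" if "x j = x m" "j \<noteq> m" for j
  proof -
    have "real (\<delta> m * n j) = real (\<delta> j * n m)"
      using that(1) n0[of j] n0[of m] by (simp add: x_def field_simps)
    then have "\<delta> m * n j = \<delta> j * n m" unfolding of_nat_eq_iff .
    then have "n m dvd \<delta> m"
      using ratio_eq_dvd[of m j] that(2) by blast
    then have "\<delta> m = n m" using pos le[of m] by (simp add: dvd_imp_le le_antisym)
    then show ?thesis by (simp add: x1_iff)
  qed
  have lt: "(if i = m then 2 - x m else x i) + (if j = m then 2 - x m else x j) < 2"
    if neq: "\<not> [\<kappa> i = \<kappa> j] (mod 2)" for i j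
  proof -
    have ij: "i \<noteq> j" using neq by auto
    have not1: "x i \<noteq> 1 \<or> x j \<noteq> 1" using mid neq unfolding x1_iff by blast
    have "x i \<noteq> x m \<or> x j \<noteq> x m"
      using not1 tie[of i] tie[of j] ij by (cases "i = m") auto
    then show ?thesis
      using ij max[of i] max[of j] x1[of i] x1[of j] not1 by (auto split: if_splits)
  qed
  have le2: "(if i = m then 2 - x m else x i) + (if j = m then 2 - x m else x j) \<le> 2"
    if "i \<noteq> j" for i j
    using that max[of i] max[of j] x1[of i] x1[of j] by auto
  have "flip n {m} \<delta> j < 2 * n j" for j
    using le[of j] pos n_pos[of j] by (auto simp: flip_def)
  then show ?thesis
    using lt le2 by (simp add: spectral_set_eq flip)
qed

text \<open>Folding all entries above \<open>n j\<close> down gives \<open>\<delta>\<close>. If the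
  number of folds is even, \<open>\<delta>\<close> is the representative; if it is odd, one further
  flip restores an even number.\<close>

lemma cos_prod_reduce:
  assumes \<gamma>: "\<And>j. \<gamma> j \<le> 2 * n j"
  shows "\<exists>\<gamma>'\<in>spectral_set n \<kappa>. \<exists>s. \<forall>k\<in>index_set n \<kappa>. cos_prod n \<gamma> k = s * cos_prod n \<gamma>' k"
proof -
  define F where "F = {j. n j < \<gamma> j}"
  define \<delta> where "\<delta> = flip n F \<gamma>"
  have \<delta>_le: "\<delta> j \<le> n j" for j
    using \<gamma>[of j] by (auto simp: \<delta>_def flip_def F_def)
  have \<delta>_le2: "\<delta> j \<le> 2 * n j" for j using \<delta>_le[of j] by simp
  have \<gamma>_flip: "\<gamma> = flip n F \<delta>"
    using \<gamma> by (auto simp: \<delta>_def flip_def)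
  define S where "S = (\<Prod>j\<in>F. par_sign (\<kappa> j))"
  have flipped: "cos_prod n \<gamma> k = S * r ^ card F * cos_prod n \<delta> k"
    if "\<And>j. par_sign (int (k j)) = par_sign (\<kappa> j) * r" for k r
    unfolding \<gamma>_flip cos_prod_flip[OF \<delta>_le2] that by (simp add: prod.distrib S_def)
  show ?thesis
  proof (cases "\<exists>i j. \<not> [\<kappa> i = \<kappa> j] (mod 2) \<and> \<delta> i = n i \<and> \<delta> j = n j")
    case True
    then have "cos_prod n \<delta> k = 0" if "k \<in> index_set n \<kappa>" for k
      using cos_prod_eq_0[OF that] by blast
    \<comment> \<open>The product vanishes on the grid, so any element serves as representative with
      factor 0.\<close>
    then have "\<forall>k\<in>index_set n \<kappa>. cos_prod n \<gamma> k = 0 * cos_prod n (top_index n) k"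
      using flipped by (metis index_set_par_sign mult_zero_left mult_zero_right)
    then show ?thesis using top_index_in_spectral_set by blast
  next
    case False
    then have mid: "\<And>i j. \<delta> i = n i \<Longrightarrow> \<delta> j = n j \<Longrightarrow> [\<kappa> i = \<kappa> j] (mod 2)" by blast
    show ?thesis
    proof (cases "even (card F)")
      case True
      have "cos_prod n \<gamma> k = S * cos_prod n \<delta> k" if "k \<in> index_set n \<kappa>" for k
      proof -
        obtain r where "r = 1 \<or> r = -1" "\<And>j. par_sign (int (k j)) = par_sign (\<kappa> j) * r"
          using index_set_par_sign[OF \<open>k \<in> _\<close>] by blast
        then show ?thesis using flipped[of k r] True by auto
      qed
      then show ?thesis using reduced_in_spectral_set[OF \<delta>_le mid] by blast
    next
      case odd: False
      \<comment> \<open>For \<open>\<delta> = 0\<close> flipping the last coordinate gives the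
        exceptional index; otherwise the coordinate with the largest ratio is flipped.\<close>
      have "\<exists>m. flip n {m} \<delta> \<in> spectral_set n \<kappa>"
      proof (cases "\<forall>j. \<delta> j = 0")
        case True
        then have "flip n {Max UNIV} \<delta> = top_index n"
          by (auto simp: flip_def top_index_def)
        then show ?thesis using top_index_in_spectral_set by metis
      next
        case False
        then obtain i where i: "0 < \<delta> i" by auto
        let ?x = "\<lambda>j. real (\<delta> j) / real (n j)"
        have "Max (range ?x) \<in> range ?x" by (intro Max_in) auto
        then obtain m where "Max (range ?x) = ?x m" by blast
        then have max: "?x j \<le> ?x m" for j
          using Max_ge[of "range ?x" "?x j"] by simp
        have "0 < ?x i" using i n_pos[of i] by simp
        then have "0 < ?x m" using max[of i] by linarith
        then have "0 < \<delta> m" by (auto simp: zero_less_divide_iff)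
        then show ?thesis using flip_max_in_spectral_set[OF \<delta>_le mid _ max] by blast
      qed
      then obtain m where m: "flip n {m} \<delta> \<in> spectral_set n \<kappa>" ..
      have "cos_prod n \<gamma> k = S * par_sign (\<kappa> m) * cos_prod n (flip n {m} \<delta>) k"
        if "k \<in> index_set n \<kappa>" for k
      proof -
        obtain r where r: "r = 1 \<or> r = -1" "\<And>j. par_sign (int (k j)) = par_sign (\<kappa> j) * r"
          using index_set_par_sign[OF \<open>k \<in> _\<close>] by blast
        then have "r ^ card F = r" using odd by auto
        moreover have "par_sign (\<kappa> m) * par_sign (\<kappa> m) = 1" by (simp add: par_sign_def)
        moreover have "cos_prod n (flip n {m} \<delta>) k = par_sign (\<kappa> m) * r * cos_prod n \<delta> k"
          by (simp add: cos_prod_flip[OF \<delta>_le2] r(2))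
        ultimately show ?thesis using flipped[OF r(2)] by simp
      qed
      then show ?thesis using m by blast
    qed
  qed
qed

text \<open>In the expansion over the full box each product is replaced by a multiple of its
  representative \<open>g \<gamma>\<close>, and the coefficients are collected over the fibres of
  \<open>g\<close>.\<close>

lemma delta_in_span:
  assumes i: "i \<in> index_set n \<kappa>"
  obtains c where "\<And>k. k \<in> index_set n \<kappa> \<Longrightarrow>
    (\<Sum>\<gamma>\<in>spectral_set n \<kappa>. c \<gamma> * cos_prod n \<gamma> k) = (if i = k then 1 else 0)"
proof -
  let ?B = "PiE UNIV (\<lambda>j. {..2 * n j})"
  obtain c where c: "\<And>k. (\<And>j. k j \<le> 2 * n j) \<Longrightarrow>
      (\<Sum>\<gamma>\<in>?B. c \<gamma> * cos_prod n \<gamma> k) = (if i = k then 1 else 0)"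
    using delta_full_grid[of n i] n_pos index_set_le[OF i] by blast
  have "\<forall>\<gamma>\<in>?B. \<exists>\<gamma>' s. \<gamma>' \<in> spectral_set n \<kappa> \<and>
      (\<forall>k\<in>index_set n \<kappa>. cos_prod n \<gamma> k = s * cos_prod n \<gamma>' k)"
  proof
    fix \<gamma> assume "\<gamma> \<in> ?B"
    then have "\<gamma> j \<le> 2 * n j" for j by (auto simp: PiE_def Pi_def)
    from cos_prod_reduce[OF this] show "\<exists>\<gamma>' s. \<gamma>' \<in> spectral_set n \<kappa> \<and>
      (\<forall>k\<in>index_set n \<kappa>. cos_prod n \<gamma> k = s * cos_prod n \<gamma>' k)" by blast
  qed
  then obtain g s where g: "\<And>\<gamma>. \<gamma> \<in> ?B \<Longrightarrow> g \<gamma> \<in> spectral_set n \<kappa>"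
    and s: "\<And>\<gamma> k. \<gamma> \<in> ?B \<Longrightarrow> k \<in> index_set n \<kappa> \<Longrightarrow> cos_prod n \<gamma> k = s \<gamma> * cos_prod n (g \<gamma>) k"
    unfolding bchoice_iff by blast
  have fin: "finite ?B" by (auto intro: finite_PiE)
  show thesis
  proof (rule that[of "\<lambda>\<gamma>'. \<Sum>\<gamma> | \<gamma> \<in> ?B \<and> g \<gamma> = \<gamma>'. c \<gamma> * s \<gamma>"])
    fix k assume k: "k \<in> index_set n \<kappa>"
    have "(\<Sum>\<gamma>'\<in>spectral_set n \<kappa>. (\<Sum>\<gamma> | \<gamma> \<in> ?B \<and> g \<gamma> = \<gamma>'. c \<gamma> * s \<gamma>) * cos_prod n \<gamma>' k)
        = (\<Sum>\<gamma>'\<in>spectral_set n \<kappa>. \<Sum>\<gamma> | \<gamma> \<in> ?B \<and> g \<gamma> = \<gamma>'. c \<gamma> * cos_prod n \<gamma> k)"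
      unfolding sum_distrib_right by (intro sum.cong refl) (auto simp: s[OF _ k])
    also have "\<dots> = (\<Sum>\<gamma>\<in>?B. c \<gamma> * cos_prod n \<gamma> k)"
      using g by (intro sum.group fin finite_spectral_set) auto
    also have "\<dots> = (if i = k then 1 else 0)"
      using index_set_le[OF k] by (rule c)
    finally show "(\<Sum>\<gamma>'\<in>spectral_set n \<kappa>. (\<Sum>\<gamma> | \<gamma> \<in> ?B \<and> g \<gamma> = \<gamma>'. c \<gamma> * s \<gamma>) * cos_prod n \<gamma>' k)
        = (if i = k then 1 else 0)" .
  qed
qed

section \<open>Interpolation\<close>

definition disc_norm_sq :: "('d \<Rightarrow> nat) \<Rightarrow> real" where
  "disc_norm_sq \<gamma> = (\<Sum>k\<in>index_set n \<kappa>. weight n k * (cos_prod n \<gamma> k * cos_prod n \<gamma> k))"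

lemma disc_norm_sq_pos: "\<gamma> \<in> spectral_set n \<kappa> \<Longrightarrow> 0 < disc_norm_sq \<gamma>"
  by (simp add: disc_norm_sq_def weight_sum_cos_prod_square)

text \<open>By orthogonality, pairing with \<open>cos_prod n \<gamma>\<close> isolates one
  coefficient. The field is generic because both real and complex coefficients occur below.\<close>

lemma weight_sum_expansion:
  assumes "\<gamma> \<in> spectral_set n \<kappa>"
  shows "(\<Sum>k\<in>index_set n \<kappa>. of_real (weight n k * cos_prod n \<gamma> k)
      * (\<Sum>\<beta>\<in>spectral_set n \<kappa>. c \<beta> * of_real (cos_prod n \<beta> k)))
    = (c \<gamma> * of_real (disc_norm_sq \<gamma>) :: 'b :: real_field)"
proof -
  have "(\<Sum>k\<in>index_set n \<kappa>. of_real (weight n k * cos_prod n \<gamma> k)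
        * (\<Sum>\<beta>\<in>spectral_set n \<kappa>. c \<beta> * of_real (cos_prod n \<beta> k)))
      = (\<Sum>\<beta>\<in>spectral_set n \<kappa>. c \<beta> *
          of_real (\<Sum>k\<in>index_set n \<kappa>. weight n k * (cos_prod n \<gamma> k * cos_prod n \<beta> k)))"
    unfolding sum_distrib_left of_real_sum by (subst sum.swap) (simp add: mult_ac)
  also have "\<dots> = (\<Sum>\<beta>\<in>spectral_set n \<kappa>. if \<beta> = \<gamma> then c \<gamma> * of_real (disc_norm_sq \<gamma>) else 0)"
  proof (rule sum.cong[OF refl])
    fix \<beta> assume "\<beta> \<in> spectral_set n \<kappa>"
    then have "(\<Sum>k\<in>index_set n \<kappa>. weight n k * (cos_prod n \<gamma> k * cos_prod n \<beta> k))
        = (if \<beta> = \<gamma> then disc_norm_sq \<gamma> else 0)"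
      using cos_prod_orthogonal[OF assms, of \<beta>] by (auto simp: disc_norm_sq_def)
    then show "c \<beta> * of_real (\<Sum>k\<in>index_set n \<kappa>. weight n k * (cos_prod n \<gamma> k * cos_prod n \<beta> k))
        = (if \<beta> = \<gamma> then c \<gamma> * of_real (disc_norm_sq \<gamma>) else 0)"
      by (simp only:) simp
  qed
  also have "\<dots> = c \<gamma> * of_real (disc_norm_sq \<gamma>)"
    using assms finite_spectral_set by simp
  finally show ?thesis .
qed

text \<open>Completeness provides some expansion of the point mass; pairing it with each
  \<open>cos_prod n \<gamma>\<close> identifies the coefficients.\<close>

lemma delta_expansion:
  assumes i: "i \<in> index_set n \<kappa>" and k: "k \<in> index_set n \<kappa>"
  shows "(\<Sum>\<gamma>\<in>spectral_set n \<kappa>. weight n i * cos_prod n \<gamma> i / disc_norm_sq \<gamma> * cos_prod n \<gamma> k)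
    = (if i = k then 1 else 0)"
proof -
  obtain c where c: "\<And>k. k \<in> index_set n \<kappa> \<Longrightarrow>
      (\<Sum>\<gamma>\<in>spectral_set n \<kappa>. c \<gamma> * cos_prod n \<gamma> k) = (if i = k then 1 else 0)"
    using delta_in_span[OF i] by blast
  have "weight n i * cos_prod n \<gamma> i / disc_norm_sq \<gamma> = c \<gamma>" if \<gamma>: "\<gamma> \<in> spectral_set n \<kappa>" for \<gamma>
  proof -
    have "c \<gamma> * disc_norm_sq \<gamma> = (\<Sum>k\<in>index_set n \<kappa>. weight n k * cos_prod n \<gamma> k * (if i = k then 1 else 0))"
      using weight_sum_expansion[OF \<gamma>, of c] by (simp add: c cong: sum.cong)
    also have "\<dots> = weight n i * cos_prod n \<gamma> i"
      using i finite_index_set[of n \<kappa>] by (simp add: if_distrib cong: if_cong)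
    finally show ?thesis using disc_norm_sq_pos[OF \<gamma>] by (simp add: field_simps)
  qed
  then show ?thesis using c[OF k] by simp
qed

section \<open>Chebyshev polynomials at the nodes and the Lagrange functions\<close>

lemma cheb_node1:
  assumes "k \<le> 2 * n j"
  shows "cheb m (node1 (2 * n j) k) = cos (real m * (real k * pi / real (2 * n j)))"
proof -
  have "real k * pi \<le> real (2 * n j) * pi" using assms by (intro mult_right_mono) auto
  then have "real k * pi / real (2 * n j) \<le> pi"
    using n_pos[of j] by (simp add: divide_le_eq mult.commute)
  then show ?thesis by (simp add: cheb_def node1_def arccos_cos)
qed

lemma node_in_cube: "node n k \<in> cube"
  by (simp add: cube_def node_def node1_def)

lemma chebT_node:
  assumes "\<And>j. k j \<le> 2 * n j"
  shows "chebT \<gamma> (node n k) = of_real (cos_prod n \<gamma> k)"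
  using node_in_cube[of k] by (simp add: chebT_def node_def cheb_node1[OF assms] cos_prod_def del: of_nat_mult)

lemma chebT_top_index:
  assumes "x \<in> cube"
  shows "chebT (top_index n) x = of_real (cheb (2 * n (Max UNIV)) (x $ Max UNIV))"
proof -
  have "(\<Prod>j\<in>UNIV. cheb (top_index n j) (x $ j)) = (\<Prod>j\<in>{Max UNIV}. cheb (top_index n j) (x $ j))"
    by (rule prod.mono_neutral_right) (auto simp: top_index_def cheb_def)
  then show ?thesis using assms by (simp add: chebT_def top_index_def)
qed

lemma defect_top_index: "defect n (top_index n) = 0"
proof -
  have "top_index n i \<noteq> n i" for i
    using n_pos[of i] by (auto simp: top_index_def)
  then show ?thesis by (simp add: defect_def)
qed

text \<open>The term subtracted in \<open>L\<^sub>i\<close> reduces the coefficient of \<open>T\<^sub>\<gamma>\<close> for \<open>\<gamma> = (0, \<dots>, 0, 2 n\<^sub>d)\<close> from 2 to 1,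
  because \<open>\<bar>T\<^sub>\<gamma>\<bar> = 1\<close> at all nodes, although its continuous squared norm is 1/2.\<close>

lemma inverse_disc_norm_sq:
  assumes \<gamma>: "\<gamma> \<in> spectral_set n \<kappa>"
  shows "1 / 2 ^ defect n \<gamma> / (cheb_norm (chebT \<gamma>))\<^sup>2 - (if \<gamma> = top_index n then 1 else 0) = 1 / disc_norm_sq \<gamma>"
proof (cases "\<gamma> = top_index n")
  case True
  have "{j. top_index n j = 0 \<or> top_index n j = 2 * n j} = UNIV"
    by (auto simp: top_index_def)
  then have "disc_norm_sq \<gamma> = 1"
    using weight_sum_cos_prod_square[OF \<gamma>] True by (simp add: disc_norm_sq_def defect_top_index)
  moreover have "{j. top_index n j > 0} = {Max UNIV}"
    using n_pos[of "Max UNIV"] by (auto simp: top_index_def)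
  ultimately show ?thesis
    using True by (simp add: cheb_norm_chebT defect_top_index)
next
  case False
  have "{j. \<gamma> j = 0 \<or> \<gamma> j = 2 * n j} = {j. \<gamma> j = 0}"
    using spectral_set_max(1)[OF \<gamma>] False by blast
  moreover have "CARD('d) = card {j. \<gamma> j = 0} + card {j. \<gamma> j > 0}"
    by (subst card_Un_disjoint[symmetric]) (auto intro: arg_cong[where f = card])
  ultimately have "disc_norm_sq \<gamma> = 2 ^ defect n \<gamma> / 2 ^ card {j. \<gamma> j > 0}"
    using weight_sum_cos_prod_square[OF \<gamma>] by (simp add: disc_norm_sq_def power_add)
  then show ?thesis
    using False by (simp add: cheb_norm_chebT)
qed

text \<open>The subtracted term is a sum over the spectral set supported at
  \<open>top_index n\<close>; merging it into the main sum turns every coefficient into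
  \<open>1 / disc_norm_sq \<gamma>\<close>. Outside the cube both sides are 0.\<close>

lemma lagrange_eq:
  assumes i: "i \<in> index_set n \<kappa>"
  shows "lagrange n \<kappa> i = (\<lambda>x. \<Sum>\<gamma>\<in>spectral_set n \<kappa>.
    of_real (weight n i * cos_prod n \<gamma> i / disc_norm_sq \<gamma>) * chebT \<gamma> x)"
proof
  fix x
  let ?b = "\<lambda>\<gamma>. 1 / 2 ^ defect n \<gamma> / (cheb_norm (chebT \<gamma>))\<^sup>2"
  show "lagrange n \<kappa> i x = (\<Sum>\<gamma>\<in>spectral_set n \<kappa>.
    of_real (weight n i * cos_prod n \<gamma> i / disc_norm_sq \<gamma>) * chebT \<gamma> x)"
  proof (cases "x \<in> cube")
    case True
    let ?t = "\<lambda>\<gamma>. chebT \<gamma> (node n i) * chebT \<gamma> x"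
    have top: "(let l = Max UNIV in
        of_real (cheb (2 * n l) (node1 (2 * n l) (i l)) * cheb (2 * n l) (x $ l))) = ?t (top_index n)"
      unfolding Let_def chebT_top_index[OF True] chebT_top_index[OF node_in_cube] by (simp add: node_def)
    have "?t (top_index n) = (\<Sum>\<gamma>\<in>spectral_set n \<kappa>. of_real (if \<gamma> = top_index n then 1 else 0) * ?t \<gamma>)"
      using top_index_in_spectral_set finite_spectral_set by (simp add: if_distrib if_distribR cong: if_cong)
    then have "lagrange n \<kappa> i x = of_real (weight n i) *
        ((\<Sum>\<gamma>\<in>spectral_set n \<kappa>. of_real (?b \<gamma>) * ?t \<gamma>)
          - (\<Sum>\<gamma>\<in>spectral_set n \<kappa>. of_real (if \<gamma> = top_index n then 1 else 0) * ?t \<gamma>))"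
      using True unfolding lagrange_def top by (simp only: if_True mult.assoc)
    also have "\<dots> = of_real (weight n i) *
        (\<Sum>\<gamma>\<in>spectral_set n \<kappa>. of_real (?b \<gamma> - (if \<gamma> = top_index n then 1 else 0)) * ?t \<gamma>)"
      by (simp only: sum_subtractf[symmetric] left_diff_distrib[symmetric] of_real_diff)
    also have "\<dots> = of_real (weight n i) * (\<Sum>\<gamma>\<in>spectral_set n \<kappa>. of_real (1 / disc_norm_sq \<gamma>) * ?t \<gamma>)"
      by (simp only: inverse_disc_norm_sq cong: sum.cong)
    also have "\<dots> = (\<Sum>\<gamma>\<in>spectral_set n \<kappa>.
        of_real (weight n i * cos_prod n \<gamma> i / disc_norm_sq \<gamma>) * chebT \<gamma> x)"
      unfolding sum_distrib_left chebT_node[OF index_set_le[OF i]]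
      by (intro sum.cong refl) simp
    finally show ?thesis .
  qed (simp add: lagrange_def chebT_def)
qed

lemma lagrange_node:
  assumes i: "i \<in> index_set n \<kappa>" and k: "k \<in> index_set n \<kappa>"
  shows "lagrange n \<kappa> i (node n k) = (if i = k then 1 else 0)"
proof -
  have "lagrange n \<kappa> i (node n k) = of_real (\<Sum>\<gamma>\<in>spectral_set n \<kappa>.
      weight n i * cos_prod n \<gamma> i / disc_norm_sq \<gamma> * cos_prod n \<gamma> k)"
    unfolding lagrange_eq[OF i] chebT_node[OF index_set_le[OF k]] of_real_sum of_real_mult ..
  then show ?thesis unfolding delta_expansion[OF i k] by simp
qed

section \<open>Linear algebra of the interpolation space\<close>

lemma lagrange_in_poly_space:
  assumes "i \<in> index_set n \<kappa>"
  shows "lagrange n \<kappa> i \<in> poly_space n \<kappa>"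
  unfolding lagrange_eq[OF assms] poly_space_def sum_fun_apply[symmetric]
  by (intro cfun.span_sum cfun.span_scale cfun.span_base imageI)

lemma interpolant_eq_sum: "interpolant n \<kappa> h = (\<Sum>i\<in>index_set n \<kappa>. (\<lambda>x. h i * lagrange n \<kappa> i x))"
  unfolding interpolant_def sum_fun_apply ..

lemma interpolant_in_poly_space: "interpolant n \<kappa> h \<in> poly_space n \<kappa>"
  using lagrange_in_poly_space unfolding interpolant_eq_sum poly_space_def
  by (intro cfun.span_sum cfun.span_scale)

lemma interpolant_node:
  assumes "k \<in> index_set n \<kappa>"
  shows "interpolant n \<kappa> h (node n k) = h k"
proof -
  have "interpolant n \<kappa> h (node n k) = (\<Sum>i\<in>index_set n \<kappa>. if i = k then h k else 0)"
    unfolding interpolant_def using lagrange_node[OF _ assms] by (intro sum.cong) auto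
  then show ?thesis using assms finite_index_set[of n \<kappa>] by simp
qed

text \<open>The combinations with coefficients indexed by multi-indices form a subspace that
  contains the generators.\<close>

lemma poly_space_expansion:
  assumes "P \<in> poly_space n \<kappa>"
  obtains c where "P = (\<lambda>x. \<Sum>\<gamma>\<in>spectral_set n \<kappa>. c \<gamma> * chebT \<gamma> x)"
proof -
  let ?E = "range (\<lambda>c x. \<Sum>\<gamma>\<in>spectral_set n \<kappa>. c \<gamma> * chebT \<gamma> x)"
  have "cfun.subspace ?E"
  proof (rule cfun.subspaceI)
    show "0 \<in> ?E" by (rule range_eqI[of _ _ "\<lambda>_. 0"]) (simp add: fun_eq_iff)
  next
    fix f g assume "f \<in> ?E" "g \<in> ?E"
    then obtain c d where "f = (\<lambda>x. \<Sum>\<gamma>\<in>spectral_set n \<kappa>. c \<gamma> * chebT \<gamma> x)"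
      "g = (\<lambda>x. \<Sum>\<gamma>\<in>spectral_set n \<kappa>. d \<gamma> * chebT \<gamma> x)" by blast
    then show "f + g \<in> ?E"
      by (intro range_eqI[of _ _ "\<lambda>\<gamma>. c \<gamma> + d \<gamma>"]) (simp add: fun_eq_iff distrib_right sum.distrib)
  next
    fix z f assume "f \<in> ?E"
    then obtain c where "f = (\<lambda>x. \<Sum>\<gamma>\<in>spectral_set n \<kappa>. c \<gamma> * chebT \<gamma> x)" by blast
    then show "(\<lambda>x. z * f x) \<in> ?E"
      by (intro range_eqI[of _ _ "\<lambda>\<gamma>. z * c \<gamma>"]) (simp add: fun_eq_iff sum_distrib_left mult.assoc)
  qed
  moreover have "chebT \<gamma> \<in> ?E" if "\<gamma> \<in> spectral_set n \<kappa>" for \<gamma>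
    using that finite_spectral_set
    by (intro range_eqI[of _ _ "\<lambda>\<beta>. if \<beta> = \<gamma> then 1 else 0"])
      (rule ext, simp add: if_distrib if_distribR cong: if_cong)
  ultimately have "poly_space n \<kappa> \<subseteq> ?E"
    unfolding poly_space_def by (intro cfun.span_minimal) auto
  then show thesis using assms that by blast
qed

text \<open>Vanishing at the nodes makes all discrete pairings zero, and the discrete norms are
  positive, so every coefficient is zero.\<close>

lemma poly_space_eq_0:
  assumes P: "P \<in> poly_space n \<kappa>" and zero: "\<And>k. k \<in> index_set n \<kappa> \<Longrightarrow> P (node n k) = 0"
  shows "P = 0"
proof -
  obtain c where c: "P = (\<lambda>x. \<Sum>\<gamma>\<in>spectral_set n \<kappa>. c \<gamma> * chebT \<gamma> x)"
    using poly_space_expansion[OF P] by blast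
  have "c \<gamma> = 0" if \<gamma>: "\<gamma> \<in> spectral_set n \<kappa>" for \<gamma>
  proof -
    have "(\<Sum>\<beta>\<in>spectral_set n \<kappa>. c \<beta> * of_real (cos_prod n \<beta> k)) = 0" if k: "k \<in> index_set n \<kappa>" for k
      using zero[OF k] unfolding c chebT_node[OF index_set_le[OF k]] .
    then have "c \<gamma> * of_real (disc_norm_sq \<gamma>) = 0"
      unfolding weight_sum_expansion[OF \<gamma>, symmetric] by simp
    then show ?thesis using disc_norm_sq_pos[OF \<gamma>] by simp
  qed
  then show ?thesis unfolding c by (simp add: fun_eq_iff)
qed

lemma poly_space_unique:
  assumes "P \<in> poly_space n \<kappa>" "Q \<in> poly_space n \<kappa>"
    and "\<And>k. k \<in> index_set n \<kappa> \<Longrightarrow> P (node n k) = Q (node n k)"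
  shows "P = Q"
proof -
  have "P - Q \<in> poly_space n \<kappa>"
    using assms(1,2) unfolding poly_space_def by (rule cfun.span_diff)
  then have "P - Q = 0" by (rule poly_space_eq_0) (simp add: assms(3))
  then show ?thesis by simp
qed

lemma poly_space_eq_interpolant:
  assumes "P \<in> poly_space n \<kappa>" "\<And>k. k \<in> index_set n \<kappa> \<Longrightarrow> P (node n k) = h k"
  shows "P = interpolant n \<kappa> h"
  using assms by (intro poly_space_unique interpolant_in_poly_space) (simp_all add: interpolant_node)

lemma span_interpolant:
  "cfun.span {interpolant n \<kappa> h | h. h \<in> fun_on (index_set n \<kappa>)} = poly_space n \<kappa>"
proof
  show "cfun.span {interpolant n \<kappa> h | h. h \<in> fun_on (index_set n \<kappa>)} \<subseteq> poly_space n \<kappa>"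
    using interpolant_in_poly_space unfolding poly_space_def
    by (intro cfun.span_minimal cfun.subspace_span) auto
next
  show "poly_space n \<kappa> \<subseteq> cfun.span {interpolant n \<kappa> h | h. h \<in> fun_on (index_set n \<kappa>)}"
  proof
    fix P assume P: "P \<in> poly_space n \<kappa>"
    \<comment> \<open>Every \<open>P\<close> interpolates its own node values; they are cut off
      outside the grid to lie in \<open>fun_on\<close>.\<close>
    define h where "h k = (if k \<in> index_set n \<kappa> then P (node n k) else 0)" for k
    have "P = interpolant n \<kappa> h"
      by (rule poly_space_eq_interpolant[OF P]) (simp add: h_def)
    moreover have "h \<in> fun_on (index_set n \<kappa>)"
      by (simp add: fun_on_def h_def)
    ultimately show "P \<in> cfun.span {interpolant n \<kappa> h | h. h \<in> fun_on (index_set n \<kappa>)}"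
      by (blast intro: cfun.span_base)
  qed
qed

lemma inj_on_lagrange: "inj_on (lagrange n \<kappa>) (index_set n \<kappa>)"
proof (rule inj_onI)
  fix i k assume "i \<in> index_set n \<kappa>" "k \<in> index_set n \<kappa>" "lagrange n \<kappa> i = lagrange n \<kappa> k"
  then show "i = k"
    using lagrange_node[of i k] lagrange_node[of k k] by (simp split: if_splits)
qed

text \<open>A vanishing linear combination is the interpolant of its coefficients, whose node values
  are these coefficients.\<close>

lemma independent_lagrange: "\<not> cfun.dependent (lagrange n \<kappa> ` index_set n \<kappa>)"
proof (rule cfun.independent_if_scalars_zero)
  fix f g
  assume sum: "(\<Sum>g\<in>lagrange n \<kappa> ` index_set n \<kappa>. (\<lambda>x. f g * g x)) = 0"
    and "g \<in> lagrange n \<kappa> ` index_set n \<kappa>"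
  then obtain k where k: "k \<in> index_set n \<kappa>" "g = lagrange n \<kappa> k" by blast
  have "interpolant n \<kappa> (\<lambda>i. f (lagrange n \<kappa> i)) = 0"
    using sum unfolding interpolant_eq_sum sum.reindex[OF inj_on_lagrange] o_def .
  then show "f g = 0"
    using interpolant_node[OF k(1), of "\<lambda>i. f (lagrange n \<kappa> i)"] k(2) by simp
qed (simp add: finite_index_set)

lemma span_lagrange: "cfun.span (lagrange n \<kappa> ` index_set n \<kappa>) = poly_space n \<kappa>"
proof
  show "cfun.span (lagrange n \<kappa> ` index_set n \<kappa>) \<subseteq> poly_space n \<kappa>"
    using lagrange_in_poly_space unfolding poly_space_def
    by (intro cfun.span_minimal cfun.subspace_span) auto
next
  have "interpolant n \<kappa> h \<in> cfun.span (lagrange n \<kappa> ` index_set n \<kappa>)" for h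
    unfolding interpolant_eq_sum
    by (intro cfun.span_sum cfun.span_scale cfun.span_base imageI)
  then show "poly_space n \<kappa> \<subseteq> cfun.span (lagrange n \<kappa> ` index_set n \<kappa>)"
    unfolding span_interpolant[symmetric] by (intro cfun.span_minimal cfun.subspace_span) auto
qed

end

text \<open>Equality with a singleton expresses existence and uniqueness together. Injectivity
  belongs to the basis property because independence of the image set does not see repeated members
  of the family.\<close>

theorem theorem3p10:
  fixes n :: "'d::{finite,linorder} \<Rightarrow> nat" and \<kappa> :: "'d \<Rightarrow> int"
  assumes "\<And>j. n j \<ge> 1"
    and "\<And>i j. i \<noteq> j \<Longrightarrow> coprime (n i) (n j)"
  shows "(\<forall>h\<in>fun_on (index_set n \<kappa>).
            {P \<in> poly_space n \<kappa>. \<forall>i\<in>index_set n \<kappa>. P (node n i) = h i} = {interpolant n \<kappa> h})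
       \<and> cfun.span {interpolant n \<kappa> h | h. h \<in> fun_on (index_set n \<kappa>)} = poly_space n \<kappa>
       \<and> inj_on (lagrange n \<kappa>) (index_set n \<kappa>)
       \<and> \<not> cfun.dependent (lagrange n \<kappa> ` index_set n \<kappa>)
       \<and> cfun.span (lagrange n \<kappa> ` index_set n \<kappa>) = poly_space n \<kappa>"
proof -
  interpret coprime_grid n \<kappa> using assms by unfold_locales
  have "{P \<in> poly_space n \<kappa>. \<forall>i\<in>index_set n \<kappa>. P (node n i) = h i} = {interpolant n \<kappa> h}" for h
    using poly_space_eq_interpolant[of _ h] interpolant_in_poly_space interpolant_node by blast
  then show ?thesis
    using span_interpolant inj_on_lagrange independent_lagrange span_lagrange by blast
qed

end
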